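(* Let $(M,\mathcal B,\mu,\Phi_t)$ be a system with pure point spectrum, $C^\infty$ Koopman eigenfunctions and $m$ basic frequencies as described in the context, with dynamical vector field $v$, let $F:M\to\mathbb R^d$ be a smooth embedding with induced metric $g$, and let $\bar g=\sum_{i,j=1}^mB_{ij}\,\beta_i\otimes\beta_j$ be the metric defined in the context. Then $v$ and the Laplace-Beltrami operator $\Delta_{\bar g}$ are commuting operators. Thus, a Koopman eigenfunction $z_k$ with corresponding eigenvalue $\lambda_k=\mathrm i\sum_{i=1}^mk_i\Omega_i$, $k=(k_1,\dots,k_m)\in\mathbb Z^m$, is also an eigenfunction of $\Delta_{\bar g}$. In particular, $\{z_k,z_k^*\}$, or, equivalently, $\{\mathrm{Re}\,z_k,\mathrm{Im}\,z_k\}$, are orthogonal eigenfunctions of $\Delta_{\bar g}$ at the corresponding eigenvalue $\sum_{i,j=1}^mB^{-1}_{ij}\Omega_i\Omega_jk_ik_j$, where $B^{-1}_{ij}$ are the elements of the inverse of the $m\times m$ matrix $[B_{ij}]$.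
   Context: Setting. $M$ is a closed, connected, compact, orientable $C^\infty$ manifold of dimension $m$ with Borel $\sigma$-algebra $\mathcal B$; $\Phi_t:M\to M$, $t\in\mathbb R$, is a smooth flow with generating smooth vector field $v$; $\mu$ is a $\Phi_t$-invariant Borel probability measure with smooth positive density in local coordinates, ergodic for the discrete-time system $\hat\Phi_n=\Phi_{nT}$, $n\in\mathbb Z$ ($T>0$ fixed). $\tilde v$ is the skew-adjoint generator of the Koopman group $U_tf=f\circ\Phi_t$ on $L^2(M,\mu)$; it extends $v$ from $C^\infty(M)$. Pure point spectrum. There are rationally independent real numbers $\Omega_1,\dots,\Omega_m$ and $C^\infty$ eigenfunctions $\zeta_i$ with $\tilde v(\zeta_i)=\mathrm i\,\Omega_i\zeta_i$, $|\zeta_i|=1$, such that the Koopman eigenfunctions $z_k=\prod_{i=1}^m\zeta_i^{k_i}$, $k\in\mathbb Z^m$, form an orthonormal basis of $L^2(M,\mu)$. The map $(\zeta_1,\dots,\zeta_m):M\to\mathbb T^m$ is a $C^\infty$ diffeomorphism, giving angle coordinates $\theta^i$ with $\zeta_i=e^{\mathrm i\theta^i}$; set $v_i=\Omega_i\frac{\partial}{\partial\theta^i}$, globally defined smooth vector fields with $v=\sum_iv_i$. Metric. $g(u_1,u_2)=F_*u_1\cdot F_*u_2$; $B_{ij}=\int_Mg(v_i,v_j)\,d\mu$; $\beta_i$ are the smooth 1-forms with $\beta_i(v_j)=\delta_{ij}$; $\bar g=\sum_{i,j=1}^mB_{ij}\beta_i\otimes\beta_j$ (this is the limit as $s\to\infty$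 of the metrics $g_s(u_1,u_2)=\frac1s\sum_{k=0}^{s-1}g(\hat\Phi_{-k*}u_1,\hat\Phi_{-k*}u_2)$ induced by delay-coordinate maps with $s$ delays). $\Delta_{\bar g}:C^\infty(M)\to C^\infty(M)$, $\Delta_{\bar g}=-\mathrm{div}_{\bar g}\,\mathrm{grad}_{\bar g}$, is the Laplace-Beltrami operator. Orthogonality is in $L^2(M,\mu)$; $z^*$ denotes the complex conjugate.
   Formalization: For k = 0, where z_0 = z_0^* = 1 and Im z_0 = 0, the claims that z_k and z_k^* are orthogonal and that Im z_k is an eigenfunction are false; these two claims are stated for k ≠ 0 only, and everything else for all k. *)

theory Defs
  imports "HOL-Analysis.Analysis" "HOL-Probability.Probability"
begin

section \<open>Smooth manifolds\<close>

text \<open>\<open>Ck_on\<close> and \<open>smooth_on\<close> are meant for open \<open>S\<close>: derivatives are taken in the full space.\<close>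

primrec Ck_on :: "nat \<Rightarrow> 'e::euclidean_space set \<Rightarrow> ('e \<Rightarrow> 'b::real_normed_vector) \<Rightarrow> bool" where
  "Ck_on 0 S f \<longleftrightarrow> continuous_on S f"
| "Ck_on (Suc k) S f \<longleftrightarrow> (\<forall>x\<in>S. f differentiable (at x)) \<and>
     (\<forall>w. Ck_on k S (\<lambda>x. frechet_derivative f (at x) w))"

definition smooth_on :: "'e::euclidean_space set \<Rightarrow> ('e \<Rightarrow> 'b::real_normed_vector) \<Rightarrow> bool" where
  "smooth_on S f \<longleftrightarrow> (\<forall>k. Ck_on k S f)"

type_synonym ('a, 'e) chart = "'a set \<times> ('a \<Rightarrow> 'e)"

text \<open>Charts map onto open subsets of the model space, so there is no boundary. The Hausdorff
  and second countability axioms come from the type class of the ambient type.\<close>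

definition smooth_atlas ::
  "'a::topological_space set \<Rightarrow> ('a, 'e::euclidean_space) chart set \<Rightarrow> bool" where
  "smooth_atlas M A \<longleftrightarrow>
     (\<Union>(U, \<phi>)\<in>A. U) = M \<and>
     (\<forall>(U, \<phi>)\<in>A. openin (top_of_set M) U \<and> open (\<phi> ` U) \<and>
        homeomorphism U (\<phi> ` U) \<phi> (inv_into U \<phi>)) \<and>
     (\<forall>(U, \<phi>)\<in>A. \<forall>(V, \<psi>)\<in>A. smooth_on (\<phi> ` (U \<inter> V)) (\<psi> \<circ> inv_into U \<phi>))"

definition orientable_atlas ::
  "'a::topological_space set \<Rightarrow> ('a, real^'m) chart set \<Rightarrow> bool" where
  "orientable_atlas M A \<longleftrightarrow>
     (\<exists>A'. smooth_atlas M A' \<and> smooth_atlas M (A \<union> A') \<and>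
        (\<forall>(U, \<phi>)\<in>A'. \<forall>(V, \<psi>)\<in>A'. \<forall>x\<in>\<phi> ` (U \<inter> V).
           det (matrix (frechet_derivative (\<psi> \<circ> inv_into U \<phi>) (at x))) > 0))"

definition smooth_map ::
  "'a::topological_space set \<Rightarrow> ('a, 'e::euclidean_space) chart set \<Rightarrow>
   'b::topological_space set \<Rightarrow> ('b, 'f::euclidean_space) chart set \<Rightarrow> ('a \<Rightarrow> 'b) \<Rightarrow> bool" where
  "smooth_map M A N A' h \<longleftrightarrow> h ` M \<subseteq> N \<and> continuous_on M h \<and>
     (\<forall>(U, \<phi>)\<in>A. \<forall>(V, \<psi>)\<in>A'.
        smooth_on (\<phi> ` (U \<inter> h -` V)) (\<psi> \<circ> h \<circ> inv_into U \<phi>))"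

definition diffeomorphism ::
  "'a::topological_space set \<Rightarrow> ('a, 'e::euclidean_space) chart set \<Rightarrow>
   'b::topological_space set \<Rightarrow> ('b, 'f::euclidean_space) chart set \<Rightarrow> ('a \<Rightarrow> 'b) \<Rightarrow> bool" where
  "diffeomorphism M A N A' h \<longleftrightarrow> bij_betw h M N \<and>
     smooth_map M A N A' h \<and> smooth_map N A' M A (inv_into M h)"

definition smooth_fun ::
  "('a, 'e::euclidean_space) chart set \<Rightarrow> ('a \<Rightarrow> 'b::real_normed_vector) \<Rightarrow> bool" where
  "smooth_fun A f \<longleftrightarrow> (\<forall>(U, \<phi>)\<in>A. smooth_on (\<phi> ` U) (f \<circ> inv_into U \<phi>))"

definition line_product_atlas ::
  "('a, 'e::euclidean_space) chart set \<Rightarrow> (real \<times> 'a, real \<times> 'e) chart set" where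
  "line_product_atlas A = (\<lambda>(U, \<phi>). (UNIV \<times> U, \<lambda>(t, p). (t, \<phi> p))) ` A"

text \<open>The torus as the product of unit circles; its charts are the local inverses of
  \<open>x \<mapsto> (exp (\<i> x\<^sub>j))\<^sub>j\<close> on open cubes of side \<open>2\<pi>\<close>.\<close>

definition torus :: "(complex^'m) set" where
  "torus = {z. \<forall>i. norm (z $ i) = 1}"

definition torus_exp :: "real^'m \<Rightarrow> complex^'m" where
  "torus_exp x = (\<chi> i. cis (x $ i))"

definition torus_atlas :: "(complex^'m, real^'m) chart set" where
  "torus_atlas = range (\<lambda>a. let Q = box (a - (\<chi> i. pi)) (a + (\<chi> i. pi))
     in (torus_exp ` Q, inv_into Q torus_exp))"


section \<open>Tangent vectors, vector fields and one-forms\<close>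

text \<open>A tangent vector is the directional derivative on \<open>C\<^sup>\<infinity>(M)\<close> along a smooth curve. The
  value \<open>0\<close> on non-smooth functions makes equality of tangent vectors extensional. From here on
  the manifold is the whole type \<open>'a\<close>.\<close>

type_synonym 'a tangent = "('a \<Rightarrow> real) \<Rightarrow> real"
type_synonym 'a vfield = "'a \<Rightarrow> 'a tangent"
type_synonym 'a oneform = "'a \<Rightarrow> 'a tangent \<Rightarrow> real"
type_synonym 'a metric_tensor = "'a \<Rightarrow> 'a tangent \<Rightarrow> 'a tangent \<Rightarrow> real"

definition velocity :: "('a, 'e::euclidean_space) chart set \<Rightarrow> (real \<Rightarrow> 'a) \<Rightarrow> 'a tangent" where
  "velocity A c = (\<lambda>f. if smooth_fun A f then vector_derivative (\<lambda>t. f (c t)) (at 0) else 0)"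

definition tangent_space ::
  "('a::topological_space, 'e::euclidean_space) chart set \<Rightarrow> 'a \<Rightarrow> 'a tangent set" where
  "tangent_space A p = {velocity A c | c. c 0 = p \<and>
     (\<exists>e>0. smooth_map {-e<..<e} {({-e<..<e}, \<lambda>t::real. t)} UNIV A c)}"

definition smooth_field ::
  "('a::topological_space, 'e::euclidean_space) chart set \<Rightarrow> 'a vfield \<Rightarrow> bool" where
  "smooth_field A X \<longleftrightarrow> (\<forall>p. X p \<in> tangent_space A p) \<and>
     (\<forall>f. smooth_fun A f \<longrightarrow> smooth_fun A (\<lambda>p. X p f))"

definition smooth_oneform ::
  "('a::topological_space, 'e::euclidean_space) chart set \<Rightarrow> 'a oneform \<Rightarrow> bool" where
  "smooth_oneform A \<beta> \<longleftrightarrow>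
     (\<forall>p. \<forall>u\<in>tangent_space A p. \<forall>w\<in>tangent_space A p. \<forall>a b.
        \<beta> p (\<lambda>f. a * u f + b * w f) = a * \<beta> p u + b * \<beta> p w) \<and>
     (\<forall>X. smooth_field A X \<longrightarrow> smooth_fun A (\<lambda>p. \<beta> p (X p)))"

definition field_add :: "'a vfield \<Rightarrow> 'a vfield \<Rightarrow> 'a vfield" where
  "field_add X Y = (\<lambda>p f. X p f + Y p f)"

definition field_scale :: "('a \<Rightarrow> real) \<Rightarrow> 'a vfield \<Rightarrow> 'a vfield" where
  "field_scale h X = (\<lambda>p f. h p * X p f)"

definition lie_bracket :: "'a vfield \<Rightarrow> 'a vfield \<Rightarrow> 'a vfield" where
  "lie_bracket X Y = (\<lambda>p f. X p (\<lambda>q. Y q f) - Y p (\<lambda>q. X q f))"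

text \<open>The differential of \<open>F : M \<rightarrow> \<real>\<^sup>d\<close>, with tangent spaces of \<open>\<real>\<^sup>d\<close> identified with \<open>\<real>\<^sup>d\<close>.\<close>

definition pushforward :: "('a \<Rightarrow> real^'d) \<Rightarrow> 'a tangent \<Rightarrow> real^'d" where
  "pushforward F u = (\<chi> j. u (\<lambda>p. F p $ j))"

definition smooth_embedding ::
  "('a::topological_space, 'e::euclidean_space) chart set \<Rightarrow> ('a \<Rightarrow> real^'d) \<Rightarrow> bool" where
  "smooth_embedding A F \<longleftrightarrow> smooth_fun A F \<and>
     (\<exists>G. homeomorphism UNIV (range F) F G) \<and>
     (\<forall>p. inj_on (pushforward F) (tangent_space A p))"

definition induced_metric :: "('a \<Rightarrow> real^'d) \<Rightarrow> 'a metric_tensor" where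
  "induced_metric F = (\<lambda>p u w. pushforward F u \<bullet> pushforward F w)"


section \<open>The Laplace--Beltrami operator\<close>

definition grad ::
  "('a::topological_space, 'e::euclidean_space) chart set \<Rightarrow> 'a metric_tensor \<Rightarrow>
   ('a \<Rightarrow> real) \<Rightarrow> 'a vfield" where
  "grad A g f = (\<lambda>p. THE x. x \<in> tangent_space A p \<and> (\<forall>u\<in>tangent_space A p. g p x u = u f))"

definition affine_connection ::
  "('a::topological_space, 'e::euclidean_space) chart set \<Rightarrow>
   ('a vfield \<Rightarrow> 'a vfield \<Rightarrow> 'a vfield) \<Rightarrow> bool" where
  "affine_connection A D \<longleftrightarrow>
     (\<forall>X Y. smooth_field A X \<and> smooth_field A Y \<longrightarrow> smooth_field A (D X Y)) \<and>
     (\<forall>X Y Z h. smooth_field A X \<and> smooth_field A Y \<and> smooth_field A Z \<and> smooth_fun A h \<longrightarrow>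
        D (field_add X Y) Z = field_add (D X Z) (D Y Z) \<and>
        D (field_scale h X) Z = field_scale h (D X Z) \<and>
        D X (field_add Y Z) = field_add (D X Y) (D X Z) \<and>
        D X (field_scale h Z) = field_add (field_scale h (D X Z)) (field_scale (\<lambda>p. X p h) Z))"

definition is_levi_civita ::
  "('a::topological_space, 'e::euclidean_space) chart set \<Rightarrow> 'a metric_tensor \<Rightarrow>
   ('a vfield \<Rightarrow> 'a vfield \<Rightarrow> 'a vfield) \<Rightarrow> bool" where
  "is_levi_civita A g D \<longleftrightarrow> affine_connection A D \<and>
     (\<forall>X Y. smooth_field A X \<and> smooth_field A Y \<longrightarrow>
        (\<forall>p f. D X Y p f - D Y X p f = lie_bracket X Y p f)) \<and>
     (\<forall>X Y Z. smooth_field A X \<and> smooth_field A Y \<and> smooth_field A Z \<longrightarrow>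
        (\<forall>p. X p (\<lambda>q. g q (Y q) (Z q)) = g p (D X Y p) (Z p) + g p (Y p) (D X Z p)))"

text \<open>Uniquely determined on smooth vector fields; \<open>SOME\<close> because its values elsewhere are
  arbitrary.\<close>

definition levi_civita ::
  "('a::topological_space, 'e::euclidean_space) chart set \<Rightarrow> 'a metric_tensor \<Rightarrow>
   'a vfield \<Rightarrow> 'a vfield \<Rightarrow> 'a vfield" where
  "levi_civita A g = (SOME D. is_levi_civita A g D)"

text \<open>The divergence of \<open>X\<close> at \<open>p\<close> is the trace of \<open>u \<mapsto> \<nabla>\<^sub>u X\<close> on the tangent space at \<open>p\<close>. It is
  computed in a \<open>g\<close>-orthonormal basis at \<open>p\<close>, extended to smooth vector fields \<open>E i\<close> (which
  need be orthonormal only at \<open>p\<close>); the result does not depend on the choice.\<close>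

definition divergence ::
  "('a::topological_space, real^'m) chart set \<Rightarrow> 'a metric_tensor \<Rightarrow> 'a vfield \<Rightarrow> 'a \<Rightarrow> real" where
  "divergence A g X p =
     (let E = (SOME E :: 'm \<Rightarrow> 'a vfield. (\<forall>i. smooth_field A (E i)) \<and>
                (\<forall>i j. g p (E i p) (E j p) = (if i = j then 1 else 0)))
      in \<Sum>i\<in>UNIV. g p (levi_civita A g (E i) X p) (E i p))"

definition laplacian_real ::
  "('a::topological_space, real^'m) chart set \<Rightarrow> 'a metric_tensor \<Rightarrow> ('a \<Rightarrow> real) \<Rightarrow> 'a \<Rightarrow> real" where
  "laplacian_real A g f = (\<lambda>p. - divergence A g (grad A g f) p)"

definition laplacian ::
  "('a::topological_space, real^'m) chart set \<Rightarrow> 'a metric_tensor \<Rightarrow>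
   ('a \<Rightarrow> complex) \<Rightarrow> 'a \<Rightarrow> complex" where
  "laplacian A g f = (\<lambda>p. Complex (laplacian_real A g (\<lambda>q. Re (f q)) p)
                                  (laplacian_real A g (\<lambda>q. Im (f q)) p))"

definition laplace_eigenfunction ::
  "('a::topological_space, real^'m) chart set \<Rightarrow> 'a metric_tensor \<Rightarrow> real \<Rightarrow>
   ('a \<Rightarrow> complex) \<Rightarrow> bool" where
  "laplace_eigenfunction A g \<eta> f \<longleftrightarrow> smooth_fun A f \<and> (\<exists>p. f p \<noteq> 0) \<and>
     (\<forall>p. laplacian A g f p = of_real \<eta> * f p)"


section \<open>Flows, invariant measures and Koopman operators\<close>

definition smooth_flow ::
  "('a::topological_space, 'e::euclidean_space) chart set \<Rightarrow> (real \<Rightarrow> 'a \<Rightarrow> 'a) \<Rightarrow> bool" where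
  "smooth_flow A \<Phi> \<longleftrightarrow> (\<forall>p. \<Phi> 0 p = p) \<and> (\<forall>s t p. \<Phi> (s + t) p = \<Phi> s (\<Phi> t p)) \<and>
     smooth_map UNIV (line_product_atlas A) UNIV A (\<lambda>(t, p). \<Phi> t p)"

definition flow_field ::
  "(real \<Rightarrow> 'a \<Rightarrow> 'a) \<Rightarrow> ('a \<Rightarrow> 'b::real_normed_vector) \<Rightarrow> 'a \<Rightarrow> 'b" where
  "flow_field \<Phi> f = (\<lambda>p. vector_derivative (\<lambda>t. f (\<Phi> t p)) (at 0))"

definition smooth_positive_density ::
  "('a::topological_space, 'e::euclidean_space) chart set \<Rightarrow> 'a measure \<Rightarrow> bool" where
  "smooth_positive_density A \<mu> \<longleftrightarrow>
     (\<forall>(U, \<phi>)\<in>A. \<exists>\<rho>. smooth_on (\<phi> ` U) \<rho> \<and> (\<forall>x\<in>\<phi> ` U. 0 < \<rho> x) \<and>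
        (\<forall>E\<in>sets borel. E \<subseteq> U \<longrightarrow>
           emeasure \<mu> E = (\<integral>\<^sup>+x. ennreal (\<rho> x) * indicator (\<phi> ` E) x \<partial>lborel)))"

definition invariant_measure :: "'a measure \<Rightarrow> (real \<Rightarrow> 'a \<Rightarrow> 'a) \<Rightarrow> bool" where
  "invariant_measure \<mu> \<Phi> \<longleftrightarrow> (\<forall>t. \<Phi> t \<in> measurable \<mu> \<mu> \<and> distr \<mu> \<mu> (\<Phi> t) = \<mu>)"

definition ergodic :: "'a measure \<Rightarrow> ('a \<Rightarrow> 'a) \<Rightarrow> bool" where
  "ergodic \<mu> S \<longleftrightarrow> (\<forall>E\<in>sets \<mu>. S -` E \<inter> space \<mu> = E \<longrightarrow> emeasure \<mu> E = 0 \<or> emeasure \<mu> E = 1)"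

definition square_integrable :: "'a measure \<Rightarrow> ('a \<Rightarrow> complex) \<Rightarrow> bool" where
  "square_integrable \<mu> f \<longleftrightarrow> f \<in> borel_measurable \<mu> \<and> integrable \<mu> (\<lambda>p. (norm (f p))\<^sup>2)"

definition L2_inner :: "'a measure \<Rightarrow> ('a \<Rightarrow> complex) \<Rightarrow> ('a \<Rightarrow> complex) \<Rightarrow> complex" where
  "L2_inner \<mu> f h = (\<integral>p. cnj (f p) * h p \<partial>\<mu>)"

definition L2_orthonormal_basis :: "'a measure \<Rightarrow> ('k \<Rightarrow> 'a \<Rightarrow> complex) \<Rightarrow> bool" where
  "L2_orthonormal_basis \<mu> z \<longleftrightarrow>
     (\<forall>k. square_integrable \<mu> (z k)) \<and>
     (\<forall>k l. L2_inner \<mu> (z k) (z l) = (if k = l then 1 else 0)) \<and>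
     (\<forall>f. square_integrable \<mu> f \<longrightarrow> (\<forall>e>0. \<exists>K c. finite K \<and>
        (\<integral>p. (norm (f p - (\<Sum>k\<in>K. c k * z k p)))\<^sup>2 \<partial>\<mu>) < e))"

text \<open>The graph of the generator of the unitary group \<open>U\<^sub>t f = f \<circ> \<Phi>\<^sub>t\<close> on \<open>L\<^sup>2(\<mu>)\<close>, elements of
  \<open>L\<^sup>2\<close> being given by representatives.\<close>

definition koopman_generator ::
  "'a measure \<Rightarrow> (real \<Rightarrow> 'a \<Rightarrow> 'a) \<Rightarrow> ('a \<Rightarrow> complex) \<Rightarrow> ('a \<Rightarrow> complex) \<Rightarrow> bool" where
  "koopman_generator \<mu> \<Phi> f h \<longleftrightarrow> square_integrable \<mu> f \<and> square_integrable \<mu> h \<and>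
     ((\<lambda>t. \<integral>p. (norm ((f (\<Phi> t p) - f p) /\<^sub>R t - h p))\<^sup>2 \<partial>\<mu>) \<longlongrightarrow> 0) (at 0)"

definition koopman_eigenfunction ::
  "'a measure \<Rightarrow> (real \<Rightarrow> 'a \<Rightarrow> 'a) \<Rightarrow> complex \<Rightarrow> ('a \<Rightarrow> complex) \<Rightarrow> bool" where
  "koopman_eigenfunction \<mu> \<Phi> c f \<longleftrightarrow>
     koopman_generator \<mu> \<Phi> f (\<lambda>p. c * f p) \<and> \<not> (AE p in \<mu>. f p = 0)"

definition monomial :: "('m::finite \<Rightarrow> 'a \<Rightarrow> complex) \<Rightarrow> int^'m \<Rightarrow> 'a \<Rightarrow> complex" where
  "monomial \<zeta> k p = (\<Prod>i\<in>UNIV. \<zeta> i p powi (k $ i))"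

definition angle_map :: "('m::finite \<Rightarrow> 'a \<Rightarrow> complex) \<Rightarrow> 'a \<Rightarrow> complex^'m" where
  "angle_map \<zeta> p = (\<chi> i. \<zeta> i p)"

text \<open>The coordinate vector field \<open>\<partial>/\<partial>\<theta>\<^sup>i\<close>: the velocity of the curve along which \<open>\<theta>\<^sup>i\<close> increases
  at unit speed and the other angles are constant.\<close>

definition angle_field ::
  "('a, 'e::euclidean_space) chart set \<Rightarrow> ('m::finite \<Rightarrow> 'a \<Rightarrow> complex) \<Rightarrow> 'm \<Rightarrow> 'a vfield" where
  "angle_field A \<zeta> i p =
     velocity A (\<lambda>t. inv (angle_map \<zeta>) (\<chi> j. if j = i then cis t * \<zeta> j p else \<zeta> j p))"

definition rationally_independent :: "('m::finite \<Rightarrow> real) \<Rightarrow> bool" where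
  "rationally_independent \<Omega> \<longleftrightarrow> (\<forall>q :: 'm \<Rightarrow> rat. (\<Sum>i\<in>UNIV. of_rat (q i) * \<Omega> i) = 0 \<longrightarrow> (\<forall>i. q i = 0))"

end

theory Submission
  imports Defs
begin

text \<open>In the angle coordinates the Koopman eigenfunctions are the characters \<open>exp (\<i> k \<bullet> \<theta>)\<close>, the
  flow is the translation \<open>\<theta> \<mapsto> \<theta> + t \<Omega>\<close>, and the averaged metric has constant coefficients
  \<open>C\<^sub>i\<^sub>j = B\<^sub>i\<^sub>j / (\<Omega>\<^sub>i \<Omega>\<^sub>j)\<close>. The connection with vanishing Christoffel symbols is then the
  Levi-Civita connection, so the Laplacian is \<open>- \<Sum>\<^sub>i\<^sub>j (C\<^sup>-\<^sup>1)\<^sub>i\<^sub>j \<partial>\<^sub>i \<partial>\<^sub>j\<close>; it commutes with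
  \<open>v = \<Sum>\<^sub>i \<Omega>\<^sub>i \<partial>\<^sub>i\<close> and is diagonal on characters. The hypothesis on the generator holds only in
  \<open>L\<^sup>2\<close>; Fatou's lemma and the full support of \<open>\<mu>\<close> turn it into a pointwise identity.\<close>

section \<open>Calculus of smooth maps\<close>

text \<open>The angles are defined only modulo 2 pi, so there is no global chart to compute in. The
  calculus is therefore pulled back along the covering map \<open>E\<close> from \<real>^m to the
  manifold, where a derivative is an ordinary Frechet derivative on a whole vector space; on the
  manifold side this rests on \<open>E\<close> having smooth local sections. A second obstacle is
  that gradient, connection and divergence are specified through \<open>THE\<close> and
  \<open>SOME\<close>. A formula for the Laplacian needs existence together with uniqueness at each
  stage: nondegeneracy of C for the gradient, uniqueness of the Levi-Civita connection, and
  independence of the trace from the orthonormal basis. The matrix C is the average of g over the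
  coordinate fields instead of the \<open>v i\<close>. It is positive definite because an embedding
  is injective on tangent vectors. Dividing by frequencies is legitimate because rational
  independence forces each of them to be nonzero.\<close>

lemma differentiable_transform_open:
  assumes "open S" "x \<in> S" "\<And>y. y \<in> S \<Longrightarrow> f y = g y" "f differentiable (at x)"
  shows "g differentiable (at x)"
  using assms unfolding differentiable_def by (blast intro: has_derivative_transform_within_open)

lemma Ck_on_cong:
  assumes "open S" "\<And>x. x \<in> S \<Longrightarrow> f x = g x" "Ck_on k S f"
  shows "Ck_on k S g"
  using assms
proof (induction k arbitrary: f g)
  case 0
  then show ?case by (simp cong: continuous_on_cong)
next
  case (Suc k)
  have "frechet_derivative f (at x) = frechet_derivative g (at x)" if "x \<in> S" for x
    using Suc.prems that by (intro frechet_derivative_transform_within_open[of f x S g]) auto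
  then have "Ck_on k S (\<lambda>x. frechet_derivative g (at x) w)" for w
    using Suc.prems by (auto intro: Suc.IH[of "\<lambda>x. frechet_derivative f (at x) w", rotated 2])
  moreover have "g differentiable (at x)" if "x \<in> S" for x
    using differentiable_transform_open[OF Suc.prems(1) that, of f g] Suc.prems(2,3) that by simp
  ultimately show ?case by simp
qed

lemma Ck_on_subset: "Ck_on k T f \<Longrightarrow> S \<subseteq> T \<Longrightarrow> Ck_on k S f"
  by (induction k arbitrary: f) (auto intro: continuous_on_subset)

text \<open>Derivatives are taken in the full space, so each order of differentiability is decided
  near each point. This is the gluing principle behind every chartwise smoothness argument
  below.\<close>

lemma Ck_on_local:
  assumes "\<And>x. x \<in> S \<Longrightarrow> \<exists>U. open U \<and> x \<in> U \<and> Ck_on k U f"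
  shows "Ck_on k S f"
  using assms
proof (induction k arbitrary: f)
  case 0
  then have "continuous (at x) f" if "x \<in> S" for x
    using that by (metis Ck_on.simps(1) continuous_on_eq_continuous_at)
  then show ?case by (simp add: continuous_at_imp_continuous_on)
next
  case (Suc k)
  have "f differentiable (at x)" if "x \<in> S" for x
    using Suc.prems[OF that] unfolding Ck_on.simps(2) by blast
  moreover have "Ck_on k S (\<lambda>x. frechet_derivative f (at x) w)" for w
  proof (rule Suc.IH)
    fix x assume "x \<in> S"
    from Suc.prems[OF this] obtain U where "open U" "x \<in> U" "Ck_on (Suc k) U f" by blast
    then show "\<exists>U. open U \<and> x \<in> U \<and> Ck_on k U (\<lambda>x. frechet_derivative f (at x) w)"
      by (intro exI[of _ U]) simp
  qed
  ultimately show ?case by simp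
qed

lemma Ck_on_Suc_imp: "Ck_on (Suc k) S f \<Longrightarrow> Ck_on k S f"
proof (induction k arbitrary: f)
  case 0
  then show ?case
    by (auto intro!: continuous_at_imp_continuous_on differentiable_imp_continuous_within)
next
  case (Suc k)
  have "Ck_on k S (\<lambda>x. frechet_derivative f (at x) w)" for w
    using Suc.prems by (intro Suc.IH) simp
  then show ?case using Suc.prems by simp
qed

lemma Ck_on_const [simp]: "Ck_on k S (\<lambda>x. c)"
  by (induction k arbitrary: c) auto

lemma Ck_on_add:
  assumes "open S" "Ck_on k S f" "Ck_on k S g"
  shows "Ck_on k S (\<lambda>x. f x + g x)"
  using assms(2,3)
proof (induction k arbitrary: f g)
  case 0
  then show ?case by (simp add: continuous_on_add)
next
  case (Suc k)
  have D: "frechet_derivative (\<lambda>x. f x + g x) (at x)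
      = (\<lambda>w. frechet_derivative f (at x) w + frechet_derivative g (at x) w)" if "x \<in> S" for x
    using Suc.prems that
    by (intro frechet_derivative_at[symmetric] has_derivative_add)
      (auto simp: frechet_derivative_works[symmetric])
  have "Ck_on k S (\<lambda>x. frechet_derivative (\<lambda>x. f x + g x) (at x) w)" for w
  proof (rule Ck_on_cong[OF \<open>open S\<close>])
    show "Ck_on k S (\<lambda>x. frechet_derivative f (at x) w + frechet_derivative g (at x) w)"
      using Suc.prems by (intro Suc.IH) auto
  qed (simp add: D)
  then show ?case using Suc.prems by simp
qed

lemma Ck_on_sum:
  assumes "open S" "\<And>i. i \<in> I \<Longrightarrow> Ck_on k S (f i)"
  shows "Ck_on k S (\<lambda>x. \<Sum>i\<in>I. f i x)"
  using assms(2)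
  by (induction I rule: infinite_finite_induct) (auto intro: Ck_on_add[OF \<open>open S\<close>])

lemma (in bounded_bilinear) Ck_on:
  fixes f :: "'e::euclidean_space \<Rightarrow> 'a" and g :: "'e \<Rightarrow> 'b"
  assumes "open S" "Ck_on k S f" "Ck_on k S g"
  shows "Ck_on k S (\<lambda>x. prod (f x) (g x))"
  using assms(2,3)
proof (induction k arbitrary: f g)
  case 0
  then show ?case by (simp add: continuous_on)
next
  case (Suc k)
  have F: "((\<lambda>x. prod (f x) (g x)) has_derivative
      (\<lambda>w. prod (f x) (frechet_derivative g (at x) w) + prod (frechet_derivative f (at x) w) (g x)))
      (at x)" if "x \<in> S" for x
    using Suc.prems that by (intro FDERIV) (auto simp: frechet_derivative_works[symmetric])
  have "Ck_on k S (\<lambda>x. frechet_derivative (\<lambda>x. prod (f x) (g x)) (at x) w)" for w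
  proof (rule Ck_on_cong[OF \<open>open S\<close>])
    show "Ck_on k S (\<lambda>x. prod (f x) (frechet_derivative g (at x) w)
        + prod (frechet_derivative f (at x) w) (g x))"
      \<comment> \<open>The Leibniz rule leaves one factor undifferentiated, so the induction
        hypothesis also needs both original factors at the lower order.\<close>
      using Suc.prems Ck_on_Suc_imp[OF Suc.prems(1)] Ck_on_Suc_imp[OF Suc.prems(2)]
      by (intro Ck_on_add[OF \<open>open S\<close>] Suc.IH) auto
  qed (simp add: frechet_derivative_at[OF F, symmetric])
  then show ?case using F by (auto simp: differentiable_def)
qed

lemma Ck_on_bounded_linear:
  assumes "open S" "Ck_on k S f" "bounded_linear L"
  shows "Ck_on k S (\<lambda>x. L (f x))"
  using assms(2)
proof (induction k arbitrary: f)
  case 0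
  then show ?case using assms(3) by (simp add: linear_continuous_on_compose bounded_linear.continuous_on)
next
  case (Suc k)
  have F: "((\<lambda>x. L (f x)) has_derivative (\<lambda>w. L (frechet_derivative f (at x) w))) (at x)" 
    if "x \<in> S" for x
    using Suc.prems that 
    by (intro bounded_linear.has_derivative[OF assms(3)]) (auto simp: frechet_derivative_works[symmetric])
  have "Ck_on k S (\<lambda>x. frechet_derivative (\<lambda>x. L (f x)) (at x) w)" for w
  proof (rule Ck_on_cong[OF \<open>open S\<close>])
    show "Ck_on k S (\<lambda>x. L (frechet_derivative f (at x) w))"
      using Suc.prems by (intro Suc.IH) auto
  qed (simp add: frechet_derivative_at[OF F, symmetric])
  then show ?case using F by (auto simp: differentiable_def)
qed

text \<open>In the chain rule the derivative of g is applied to a vector that moves with x, whereas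
  \<open>Ck_on\<close> speaks of fixed directions. Expanding the moving vector over
  \<open>Basis\<close> gives a sum of products, to which the induction hypothesis and the product
  rule apply.\<close>

lemma Ck_on_compose:
  fixes f :: "'e::euclidean_space \<Rightarrow> 'f::euclidean_space" and g :: "'f \<Rightarrow> 'b::real_normed_vector"
  assumes "open S" "open T" "f ` S \<subseteq> T" "Ck_on k S f" "Ck_on k T g"
  shows "Ck_on k S (\<lambda>x. g (f x))"
  using assms(4,5)
proof (induction k arbitrary: g)
  case 0
  then show ?case using assms(3) by (auto intro: continuous_on_compose2)
next
  case (Suc k)
  have dg: "g differentiable (at (f x))" and df: "f differentiable (at x)" if "x \<in> S" for x
    using Suc.prems that assms(3) by auto
  have F: "((\<lambda>x. g (f x)) has_derivative
      (\<lambda>w. frechet_derivative g (at (f x)) (frechet_derivative f (at x) w))) (at x)"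
    if "x \<in> S" for x
    using has_derivative_compose[of f _ x UNIV g] dg[OF that] df[OF that]
    unfolding frechet_derivative_works by blast
  have "Ck_on k S (\<lambda>x. frechet_derivative (\<lambda>x. g (f x)) (at x) w)" for w
  proof (rule Ck_on_cong[OF \<open>open S\<close>])
    have "Ck_on k S (\<lambda>x. frechet_derivative g (at (f x)) b)" for b
      using Suc.prems Ck_on_Suc_imp by (intro Suc.IH) auto
    then show "Ck_on k S (\<lambda>x. \<Sum>b\<in>Basis. (frechet_derivative f (at x) w \<bullet> b) *\<^sub>R
        frechet_derivative g (at (f x)) b)"
      using Suc.prems
      by (intro Ck_on_sum[OF \<open>open S\<close>] bounded_bilinear.Ck_on[OF bounded_bilinear_scaleR \<open>open S\<close>]
          Ck_on_bounded_linear[OF \<open>open S\<close> _ bounded_linear_inner_left]) auto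
    fix x assume x: "x \<in> S"
    interpret G: linear "frechet_derivative g (at (f x))"
      using dg[OF x] by (rule linear_frechet_derivative)
    have "frechet_derivative g (at (f x)) (frechet_derivative f (at x) w)
        = frechet_derivative g (at (f x)) (\<Sum>b\<in>Basis. (frechet_derivative f (at x) w \<bullet> b) *\<^sub>R b)"
      by (simp add: euclidean_representation)
    then show "(\<Sum>b\<in>Basis. (frechet_derivative f (at x) w \<bullet> b) *\<^sub>R frechet_derivative g (at (f x)) b)
        = frechet_derivative (\<lambda>x. g (f x)) (at x) w"
      by (simp add: frechet_derivative_at[OF F[OF x], symmetric] G.sum G.scale)
  qed
  then show ?case using F by (auto simp: differentiable_def)
qed

lemma smooth_on_cong: "smooth_on S f \<Longrightarrow> open S \<Longrightarrow> (\<And>x. x \<in> S \<Longrightarrow> f x = g x) \<Longrightarrow> smooth_on S g"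
  unfolding smooth_on_def using Ck_on_cong by metis

lemma smooth_on_subset: "smooth_on T f \<Longrightarrow> S \<subseteq> T \<Longrightarrow> smooth_on S f"
  unfolding smooth_on_def using Ck_on_subset by metis

lemma smooth_on_local:
  "(\<And>x. x \<in> S \<Longrightarrow> \<exists>U. open U \<and> x \<in> U \<and> smooth_on U f) \<Longrightarrow> smooth_on S f"
  unfolding smooth_on_def by (meson Ck_on_local)

lemma smooth_on_const [simp]: "smooth_on S (\<lambda>x. c)"
  by (simp add: smooth_on_def)

lemma smooth_on_add:
  "open S \<Longrightarrow> smooth_on S f \<Longrightarrow> smooth_on S g \<Longrightarrow> smooth_on S (\<lambda>x. f x + g x)"
  by (simp add: smooth_on_def Ck_on_add)

lemma smooth_on_mult:
  fixes f g :: "'e::euclidean_space \<Rightarrow> real"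
  shows "open S \<Longrightarrow> smooth_on S f \<Longrightarrow> smooth_on S g \<Longrightarrow> smooth_on S (\<lambda>x. f x * g x)"
  by (simp add: smooth_on_def bounded_bilinear.Ck_on[OF bounded_bilinear_mult])

lemma smooth_on_bounded_linear:
  "open S \<Longrightarrow> smooth_on S f \<Longrightarrow> bounded_linear L \<Longrightarrow> smooth_on S (\<lambda>x. L (f x))"
  by (simp add: smooth_on_def Ck_on_bounded_linear)

lemma smooth_on_linear: "bounded_linear L \<Longrightarrow> smooth_on S L"
proof -
  assume L: "bounded_linear L"
  have "Ck_on k S L" for k
  proof (cases k)
    case (Suc j)
    have "(L has_derivative L) (at x)" for x
      using L by (rule bounded_linear_imp_has_derivative)
    then show ?thesis
      by (auto simp: Suc differentiable_def frechet_derivative_at[of L L, symmetric])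
  qed (simp add: L linear_continuous_on)
  then show ?thesis by (simp add: smooth_on_def)
qed

lemma smooth_on_compose:
  fixes f :: "'e::euclidean_space \<Rightarrow> 'f::euclidean_space"
  shows "open S \<Longrightarrow> open T \<Longrightarrow> smooth_on S f \<Longrightarrow> smooth_on T g \<Longrightarrow> f ` S \<subseteq> T \<Longrightarrow>
    smooth_on S (\<lambda>x. g (f x))"
  unfolding smooth_on_def using Ck_on_compose by blast

lemma smooth_on_imp_continuous_on: "smooth_on S f \<Longrightarrow> continuous_on S f"
  unfolding smooth_on_def by (metis Ck_on.simps(1))

lemma smooth_on_imp_differentiable: "smooth_on S f \<Longrightarrow> x \<in> S \<Longrightarrow> f differentiable (at x)"
  unfolding smooth_on_def by (metis Ck_on.simps(2))

lemma smooth_on_frechet_derivative: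
  "smooth_on S f \<Longrightarrow> smooth_on S (\<lambda>x. frechet_derivative f (at x) w)"
  unfolding smooth_on_def by (metis Ck_on.simps(2))

section \<open>Symmetry of second derivatives\<close>

lemma DERIV_along_line:
  fixes f :: "'e::real_normed_vector \<Rightarrow> real"
  assumes "f differentiable (at (x + t *\<^sub>R u))"
  shows "((\<lambda>t. f (x + t *\<^sub>R u)) has_real_derivative frechet_derivative f (at (x + t *\<^sub>R u)) u) (at t)"
proof -
  have "((\<lambda>t. x + t *\<^sub>R u) has_vector_derivative u) (at t)"
    by (auto intro!: derivative_eq_intros)
  moreover have "(f has_derivative frechet_derivative f (at (x + t *\<^sub>R u))) (at (x + t *\<^sub>R u))"
    using assms frechet_derivative_works by blast
  ultimately show ?thesis
    by (simp add: vector_derivative_diff_chain_within[of "\<lambda>t. x + t *\<^sub>R u" u t UNIV f, simplified o_def]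
        has_real_derivative_iff_has_vector_derivative has_derivative_at_withinI)
qed

text \<open>The mean value theorem is used twice: in direction u for the increment along w, then in
  direction w for the resulting derivative. The second difference is symmetric in u and w although
  the mixed derivative on the right is not visibly so.\<close>

lemma second_difference_eq:
  fixes f :: "'e::euclidean_space \<Rightarrow> real"
  assumes "smooth_on UNIV f" "s > 0"
  shows "\<exists>\<xi> \<eta>. 0 < \<xi> \<and> \<xi> < s \<and> 0 < \<eta> \<and> \<eta> < s \<and>
    f (x + s *\<^sub>R u + s *\<^sub>R w) - f (x + s *\<^sub>R u) - (f (x + s *\<^sub>R w) - f x)
    = s * s * frechet_derivative (\<lambda>y. frechet_derivative f (at y) u) (at (x + \<xi> *\<^sub>R u + \<eta> *\<^sub>R w)) w"
proof -
  define G where "G r = f (x + s *\<^sub>R w + r *\<^sub>R u) - f (x + r *\<^sub>R u)" for r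
  have "(G has_real_derivative
      frechet_derivative f (at (x + s *\<^sub>R w + r *\<^sub>R u)) u - frechet_derivative f (at (x + r *\<^sub>R u)) u)
      (at r)" for r
    unfolding G_def
    by (intro DERIV_diff DERIV_along_line smooth_on_imp_differentiable[OF assms(1)]) auto
  from MVT2[OF \<open>s > 0\<close> this] obtain \<xi> where \<xi>: "0 < \<xi>" "\<xi> < s"
    "G s - G 0 = s * (frechet_derivative f (at (x + s *\<^sub>R w + \<xi> *\<^sub>R u)) u
      - frechet_derivative f (at (x + \<xi> *\<^sub>R u)) u)" by auto
  have "((\<lambda>r. frechet_derivative f (at (x + \<xi> *\<^sub>R u + r *\<^sub>R w)) u) has_real_derivative
      frechet_derivative (\<lambda>y. frechet_derivative f (at y) u) (at (x + \<xi> *\<^sub>R u + r *\<^sub>R w)) w) (at r)" for r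
    by (rule DERIV_along_line smooth_on_imp_differentiable smooth_on_frechet_derivative assms)+ simp
  from MVT2[OF \<open>s > 0\<close> this] obtain \<eta> where \<eta>: "0 < \<eta>" "\<eta> < s"
    "frechet_derivative f (at (x + \<xi> *\<^sub>R u + s *\<^sub>R w)) u - frechet_derivative f (at (x + \<xi> *\<^sub>R u)) u
     = s * frechet_derivative (\<lambda>y. frechet_derivative f (at y) u) (at (x + \<xi> *\<^sub>R u + \<eta> *\<^sub>R w)) w" by auto
  show ?thesis
    using \<xi> \<eta> by (intro exI[of _ \<xi>] exI[of _ \<eta>]) (simp add: G_def algebra_simps)
qed

lemma frechet_derivative_commute:
  fixes f :: "'e::euclidean_space \<Rightarrow> real"
  assumes "smooth_on UNIV f"
  shows "frechet_derivative (\<lambda>y. frechet_derivative f (at y) u) (at x) w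
    = frechet_derivative (\<lambda>y. frechet_derivative f (at y) w) (at x) u"
proof -
  define D where "D u w = (\<lambda>y. frechet_derivative (\<lambda>y. frechet_derivative f (at y) u) (at y) w)" for u w
  have cont: "continuous_on UNIV (D u w)" for u w
    unfolding D_def by (intro smooth_on_imp_continuous_on smooth_on_frechet_derivative assms)
  define s where "s n = 1 / real (Suc n)" for n
  have s: "s n > 0" for n by (simp add: s_def)
  have s0: "s \<longlonglongrightarrow> 0" unfolding s_def by (rule LIMSEQ_Suc[OF lim_1_over_n])
  define q where "q n = (f (x + s n *\<^sub>R u + s n *\<^sub>R w) - f (x + s n *\<^sub>R u) - f (x + s n *\<^sub>R w) + f x)
    / (s n * s n)" for n
  \<comment> \<open>The quotient \<open>q\<close> is symmetric in the two directions, so the same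
    sequence converges to the mixed derivative in either order; uniqueness of limits then finishes
    the proof.\<close>
  have lim: "q \<longlonglongrightarrow> D a b x" if ab: "(a = u \<and> b = w) \<or> (a = w \<and> b = u)" for a b
  proof -
    have "\<exists>\<xi> \<eta>. 0 < \<xi> \<and> \<xi> < s n \<and> 0 < \<eta> \<and> \<eta> < s n \<and> q n = D a b (x + \<xi> *\<^sub>R a + \<eta> *\<^sub>R b)" for n
      using second_difference_eq[OF assms s[of n], of x a b] s[of n] ab
      by (auto simp: q_def D_def field_simps) (metis add.commute)+
    then obtain \<xi> \<eta> where *: "\<And>n. 0 < \<xi> n" "\<And>n. \<xi> n < s n" "\<And>n. 0 < \<eta> n" "\<And>n. \<eta> n < s n"
      "\<And>n. q n = D a b (x + \<xi> n *\<^sub>R a + \<eta> n *\<^sub>R b)" by metis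
    have "\<xi> \<longlonglongrightarrow> 0" "\<eta> \<longlonglongrightarrow> 0"
      by (rule tendsto_sandwich[OF _ _ tendsto_const s0]; simp add: less_imp_le * )+
    then have "(\<lambda>n. x + \<xi> n *\<^sub>R a + \<eta> n *\<^sub>R b) \<longlonglongrightarrow> x + 0 *\<^sub>R a + 0 *\<^sub>R b"
      by (intro tendsto_intros)
    moreover have "isCont (D a b) x"
      using cont[of a b] by (simp add: continuous_on_eq_continuous_at)
    ultimately show ?thesis
      using isCont_tendsto_compose[of x "D a b"] by (simp add: *(5)[abs_def])
  qed
  show ?thesis
    using LIMSEQ_unique[OF lim[of u w] lim[of w u]] by (simp add: D_def)
qed

section \<open>Angle coordinates on the manifold\<close>

text \<open>Equality of \<open>cis\<close> fixes each coordinate modulo 2 pi, and two points of an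
  open interval of length 2 pi differ by less than that.\<close>

lemma inj_on_torus_exp_box:
  fixes a :: "real^'m"
  shows "inj_on torus_exp (box (a - (\<chi> i. pi)) (a + (\<chi> i. pi)))"
proof (rule inj_onI)
  fix x y :: "real^'m"
  assume *: "x \<in> box (a - (\<chi> i. pi)) (a + (\<chi> i. pi))" "y \<in> box (a - (\<chi> i. pi)) (a + (\<chi> i. pi))"
    and eq: "torus_exp x = torus_exp y"
  have "x $ i = y $ i" for i
  proof -
    have "cis (x $ i) = cis (y $ i)"
      using eq by (simp add: torus_exp_def vec_eq_iff)
    then obtain n :: int where n: "x $ i = y $ i + 2 * pi * n"
      using sin_cos_eq_iff[of "x $ i" "y $ i"] by (auto simp: complex_eq_iff)
    have "\<bar>x $ i - y $ i\<bar> < 2 * pi"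
      using * by (auto simp: mem_box_cart dest!: spec[of _ i])
    then have "2 * pi * \<bar>real_of_int n\<bar> < 2 * pi * 1"
      using n by (simp add: abs_mult)
    then have "n = 0" by (simp add: mult_less_cancel_left_pos)
    then show ?thesis using n by simp
  qed
  then show "x = y" by (simp add: vec_eq_iff)
qed

text \<open>Describes a torus chart domain by finitely many inequations, which makes its preimage
  under the angle map visibly open in \<open>local_section\<close>. The excluded values are
  antipodal to the centre, where the branch of the argument jumps.\<close>

lemma torus_exp_box:
  "torus_exp ` box (a - (\<chi> i. pi)) (a + (\<chi> i. pi)) = {z \<in> torus. \<forall>i. z $ i \<noteq> - cis (a $ i)}"
proof (intro set_eqI iffI)
  fix z assume "z \<in> torus_exp ` box (a - (\<chi> i. pi)) (a + (\<chi> i. pi))"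
  then obtain x where x: "x \<in> box (a - (\<chi> i. pi)) (a + (\<chi> i. pi))" "z = torus_exp x" by blast
  have "cis (x $ i) \<noteq> - cis (a $ i)" for i
  proof
    assume "cis (x $ i) = - cis (a $ i)"
    then have "cis (x $ i) = cis (a $ i + pi)" by (simp add: minus_cis)
    then obtain n :: int where n: "x $ i = a $ i + pi + 2 * pi * n"
      using sin_cos_eq_iff[of "x $ i" "a $ i + pi"] by (auto simp: complex_eq_iff)
    have "- pi < x $ i - a $ i" "x $ i - a $ i < pi"
      using x by (auto simp: mem_box_cart algebra_simps dest!: spec[of _ i])
    then have "2 * pi * real_of_int n < 2 * pi * 0" "2 * pi * (-1) < 2 * pi * real_of_int n"
      using n by auto
    then have "real_of_int n < 0" "-1 < real_of_int n"
      by (auto simp only: mult_less_cancel_left_pos[of "2 * pi"] mult_pos_pos pi_gt_zero zero_less_numeral)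
    then have "n < 0" "-1 < n" by linarith+
    then show False by simp
  qed
  then show "z \<in> {z \<in> torus. \<forall>i. z $ i \<noteq> - cis (a $ i)}"
    by (simp add: x(2) torus_def torus_exp_def)
next
  fix z assume "z \<in> {z \<in> torus. \<forall>i. z $ i \<noteq> - cis (a $ i)}"
  then have z: "norm (z $ i) = 1" "z $ i \<noteq> - cis (a $ i)" for i by (auto simp: torus_def)
  define t where "t i = Arg (z $ i / cis (a $ i))" for i
  have t: "cis (t i) = z $ i / cis (a $ i)" for i
  proof -
    have "norm (z $ i / cis (a $ i)) = 1" using z by (simp add: norm_divide)
    moreover from this have "z $ i / cis (a $ i) \<noteq> 0" by (metis norm_zero zero_neq_one)
    ultimately show ?thesis
      by (simp add: t_def cis_Arg sgn_div_norm)
  qed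
  \<comment> \<open>\<open>Arg\<close> takes values in (-pi, pi], so leaving out the antipode
    removes exactly the endpoint that is not in the open box.\<close>
  have "t i \<noteq> pi" for i
  proof
    assume "t i = pi"
    with t[of i] have "z $ i = - cis (a $ i)" by (simp add: field_simps)
    with z show False by simp
  qed
  then have "- pi < t i \<and> t i < pi" for i
    using Arg_bounded[of "z $ i / cis (a $ i)"] unfolding t_def by (meson order_le_less)
  then have "a + (\<chi> i. t i) \<in> box (a - (\<chi> i. pi)) (a + (\<chi> i. pi))"
    by (auto simp: mem_box_cart)
  moreover have "torus_exp (a + (\<chi> i. t i)) = z"
    by (simp add: torus_exp_def vec_eq_iff cis_mult[symmetric] t)
  ultimately show "z \<in> torus_exp ` box (a - (\<chi> i. pi)) (a + (\<chi> i. pi))"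
    by (metis image_eqI)
qed

lemma continuous_on_torus_exp: "continuous_on S torus_exp"
  unfolding torus_exp_def[abs_def] by (intro continuous_intros)

section \<open>Charts and smooth functions on the manifold\<close>

locale smooth_manifold =
  fixes A :: "('a::{second_countable_topology, t2_space}, 'e::euclidean_space) chart set"
  assumes atlas: "smooth_atlas UNIV A"
begin

lemma chart_exists: "\<exists>U \<phi>. (U, \<phi>) \<in> A \<and> p \<in> U"
  using atlas unfolding smooth_atlas_def by blast

lemma
  assumes "(U, \<phi>) \<in> A"
  shows open_chart_domain: "open U" and open_chart_image: "open (\<phi> ` U)"
    and homeomorphism_chart: "homeomorphism U (\<phi> ` U) \<phi> (inv_into U \<phi>)"
  using assms atlas unfolding smooth_atlas_def by auto

lemma chart_inverse:
  assumes "(U, \<phi>) \<in> A" "p \<in> U"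
  shows "inv_into U \<phi> (\<phi> p) = p"
  using homeomorphism_chart[OF assms(1)] assms(2) by (simp add: homeomorphism_def)

lemma continuous_on_chart: "(U, \<phi>) \<in> A \<Longrightarrow> continuous_on U \<phi>"
  using homeomorphism_chart by (simp add: homeomorphism_def)

lemma continuous_on_chart_inverse: "(U, \<phi>) \<in> A \<Longrightarrow> continuous_on (\<phi> ` U) (inv_into U \<phi>)"
  using homeomorphism_chart by (simp add: homeomorphism_def)

lemma open_chart_image_subset:
  assumes "(U, \<phi>) \<in> A" "open V" "V \<subseteq> U"
  shows "open (\<phi> ` V)"
proof -
  have "openin (top_of_set U) V"
    using assms open_chart_domain[OF assms(1)] by (simp add: openin_open_eq)
  then have "openin (top_of_set (\<phi> ` U)) (\<phi> ` V)"
    using homeomorphism_imp_open_map homeomorphism_chart[OF assms(1)] by blast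
  then show ?thesis
    using open_chart_image[OF assms(1)] openin_open_trans by blast
qed

lemma smooth_funI:
  "(\<And>U \<phi>. (U, \<phi>) \<in> A \<Longrightarrow> smooth_on (\<phi> ` U) (\<lambda>x. f (inv_into U \<phi> x))) \<Longrightarrow> smooth_fun A f"
  unfolding smooth_fun_def o_def by fast

lemma smooth_funD:
  "smooth_fun A f \<Longrightarrow> (U, \<phi>) \<in> A \<Longrightarrow> smooth_on (\<phi> ` U) (\<lambda>x. f (inv_into U \<phi> x))"
  unfolding smooth_fun_def by (drule (1) bspec) (simp add: o_def)

lemma smooth_fun_imp_continuous:
  assumes "smooth_fun A f"
  shows "continuous_on UNIV f"
proof -
  have "continuous (at p) f" for p
  proof -
    obtain U \<phi> where U: "(U, \<phi>) \<in> A" "p \<in> U" using chart_exists by blast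
    have "continuous_on (\<phi> ` U) (f \<circ> inv_into U \<phi>)"
      using smooth_funD[OF assms U(1)] unfolding o_def by (rule smooth_on_imp_continuous_on)
    from continuous_on_compose[OF continuous_on_chart[OF U(1)] this]
    have "continuous_on U ((f \<circ> inv_into U \<phi>) \<circ> \<phi>)" .
    then have "continuous_on U f"
      using chart_inverse[OF U(1)] by (simp cong: continuous_on_cong)
    then show ?thesis
      using open_chart_domain[OF U(1)] U(2) by (simp add: continuous_on_eq_continuous_at)
  qed
  then show ?thesis by (simp add: continuous_at_imp_continuous_on)
qed

lemma smooth_fun_const [simp]: "smooth_fun A (\<lambda>p. c)"
  by (simp add: smooth_fun_def o_def)

lemma smooth_fun_bounded_linear:
  assumes "smooth_fun A f" "bounded_linear L"
  shows "smooth_fun A (\<lambda>p. L (f p))"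
  by (rule smooth_funI)
    (intro smooth_on_bounded_linear[OF _ _ assms(2)] open_chart_image smooth_funD[OF assms(1)])

lemma smooth_fun_add: "smooth_fun A f \<Longrightarrow> smooth_fun A g \<Longrightarrow> smooth_fun A (\<lambda>p. f p + g p)"
  by (rule smooth_funI) (intro smooth_on_add open_chart_image smooth_funD; assumption)

lemma smooth_fun_mult:
  fixes f g :: "'a \<Rightarrow> real"
  shows "smooth_fun A f \<Longrightarrow> smooth_fun A g \<Longrightarrow> smooth_fun A (\<lambda>p. f p * g p)"
  by (rule smooth_funI) (intro smooth_on_mult open_chart_image smooth_funD; assumption)

lemma smooth_fun_sum:
  "(\<And>i. i \<in> I \<Longrightarrow> smooth_fun A (f i)) \<Longrightarrow> smooth_fun A (\<lambda>p. \<Sum>i\<in>I. f i p)"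
  by (induction I rule: infinite_finite_induct) (auto intro: smooth_fun_add)

lemma smooth_fun_cmult: "smooth_fun A f \<Longrightarrow> smooth_fun A (\<lambda>p. c * f p :: real)"
  by (simp add: smooth_fun_mult)

lemma smooth_fun_Complex:
  assumes "smooth_fun A f" "smooth_fun A g"
  shows "smooth_fun A (\<lambda>p. Complex (f p) (g p))"
proof -
  have "smooth_fun A (\<lambda>p. f p *\<^sub>R 1 + g p *\<^sub>R \<i>)"
    by (intro smooth_fun_add smooth_fun_bounded_linear[OF assms(1)]
        smooth_fun_bounded_linear[OF assms(2)] bounded_linear_scaleR_left)
  moreover have "(\<lambda>p. f p *\<^sub>R 1 + g p *\<^sub>R \<i>) = (\<lambda>p. Complex (f p) (g p))"
    by (simp add: fun_eq_iff complex_eq_iff)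
  ultimately show ?thesis by simp
qed

lemma smooth_fun_Re: "smooth_fun A f \<Longrightarrow> smooth_fun A (\<lambda>p. Re (f p))"
  by (rule smooth_fun_bounded_linear[OF _ bounded_linear_Re])

lemma smooth_fun_Im: "smooth_fun A f \<Longrightarrow> smooth_fun A (\<lambda>p. Im (f p))"
  by (rule smooth_fun_bounded_linear[OF _ bounded_linear_Im])

end

locale torus_coordinates = smooth_manifold A
  for A :: "('a::{second_countable_topology, t2_space}, real^'m) chart set" +
  fixes \<zeta> :: "'m \<Rightarrow> 'a \<Rightarrow> complex"
  assumes diffeo: "diffeomorphism UNIV A torus torus_atlas (angle_map \<zeta>)"
begin

text \<open>The universal covering map, inverse to the multivalued coordinates \<open>(\<theta>\<^sup>1, \<dots>, \<theta>\<^sup>m)\<close>.\<close>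

definition E :: "real^'m \<Rightarrow> 'a" where
  "E x = inv (angle_map \<zeta>) (torus_exp x)"

lemma bij: "bij_betw (angle_map \<zeta>) UNIV torus"
  using diffeo by (simp add: diffeomorphism_def)

lemma torus_exp_in_torus: "torus_exp x \<in> torus"
  by (simp add: torus_exp_def torus_def)

lemma angle_map_E [simp]: "angle_map \<zeta> (E x) = torus_exp x"
  using bij torus_exp_in_torus unfolding E_def
  by (metis bij_betw_imp_surj_on f_inv_into_f)

lemma zeta_E [simp]: "\<zeta> i (E x) = cis (x $ i)"
  using angle_map_E[of x] by (simp add: angle_map_def torus_exp_def vec_eq_iff)

lemma E_eqI: "(\<And>i. \<zeta> i p = cis (x $ i)) \<Longrightarrow> E x = p"
proof -
  assume "\<And>i. \<zeta> i p = cis (x $ i)"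
  then have "torus_exp x = angle_map \<zeta> p"
    by (simp add: torus_exp_def angle_map_def)
  then show ?thesis
    using bij by (simp add: E_def bij_betw_def)
qed

lemma norm_zeta: "norm (\<zeta> i p) = 1"
proof -
  have "angle_map \<zeta> p \<in> torus" using bij by (auto simp: bij_betw_def)
  then show ?thesis by (simp add: torus_def angle_map_def)
qed

lemma E_surj: "\<exists>x. p = E x"
proof -
  have "\<zeta> i p = cis (Arg (\<zeta> i p))" for i
  proof -
    have "\<zeta> i p \<noteq> 0" using norm_zeta[of i p] by force
    then show ?thesis using norm_zeta[of i p] by (simp add: cis_Arg sgn_div_norm)
  qed
  then have "E (\<chi> i. Arg (\<zeta> i p)) = p" by (intro E_eqI) simp
  then show ?thesis by metis
qed

lemma smooth_map_angle_map: "smooth_map UNIV A torus torus_atlas (angle_map \<zeta>)"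
  and smooth_map_inv_angle_map: "smooth_map torus torus_atlas UNIV A (inv (angle_map \<zeta>))"
  using diffeo by (auto simp: diffeomorphism_def)

lemma continuous_on_E: "continuous_on S E"
proof -
  have "continuous_on torus (inv (angle_map \<zeta>))"
    using smooth_map_inv_angle_map by (simp add: smooth_map_def)
  then have "continuous_on S (\<lambda>x. inv (angle_map \<zeta>) (torus_exp x))"
    using continuous_on_compose2 continuous_on_torus_exp torus_exp_in_torus by blast
  then show ?thesis by (simp add: E_def[abs_def])
qed

lemma open_vimage_E: "open U \<Longrightarrow> open (E -` U)"
  using continuous_on_E[of UNIV] by (simp add: continuous_on_open_vimage)

lemma torus_atlas_box:
  "(torus_exp ` box (a - (\<chi> i. pi)) (a + (\<chi> i. pi)),
    inv_into (box (a - (\<chi> i. pi)) (a + (\<chi> i. pi))) torus_exp) \<in> torus_atlas"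
  unfolding torus_atlas_def Let_def by blast

lemma smooth_on_chart_E:
  assumes U: "(U, \<phi>) \<in> A"
  shows "smooth_on (E -` U) (\<lambda>x. \<phi> (E x))"
proof (rule smooth_on_local)
  fix x assume x: "x \<in> E -` U"
  \<comment> \<open>The torus chart is centred at x itself. The inverse of this chart is
    \<open>torus_exp\<close> on the box, so \<open>E\<close> there is the inverse angle map read in
    coordinates.\<close>
  define Q where "Q = box (x - (\<chi> i. pi)) (x + (\<chi> i. pi))"
  define V where "V = torus_exp ` Q"
  define \<psi> where "\<psi> = inv_into Q torus_exp"
  have inj: "inj_on torus_exp Q" unfolding Q_def by (rule inj_on_torus_exp_box)
  have psi: "\<psi> (torus_exp y) = y" if "y \<in> Q" for y
    using inj that by (simp add: \<psi>_def)
  have "inj_on \<psi> V"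
    by (rule inj_onI) (auto simp: V_def psi)
  then have inv_psi: "inv_into V \<psi> y = torus_exp y" if "y \<in> Q" for y
    using inv_into_f_f[of \<psi> V "torus_exp y"] that by (simp add: V_def psi)
  have "(V, \<psi>) \<in> torus_atlas"
    unfolding V_def \<psi>_def Q_def by (rule torus_atlas_box)
  then have sm: "smooth_on (\<psi> ` (V \<inter> inv (angle_map \<zeta>) -` U)) (\<phi> \<circ> inv (angle_map \<zeta>) \<circ> inv_into V \<psi>)"
    using smooth_map_inv_angle_map U unfolding smooth_map_def by fast
  have eq: "\<psi> ` (V \<inter> inv (angle_map \<zeta>) -` U) = Q \<inter> E -` U"
    by (force simp: V_def psi E_def image_iff)
  have op: "open (Q \<inter> E -` U)"
    unfolding Q_def using open_vimage_E open_chart_domain[OF U] by auto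
  have "smooth_on (Q \<inter> E -` U) (\<lambda>x. \<phi> (E x))"
    using sm unfolding eq by (rule smooth_on_cong[OF _ op]) (simp add: inv_psi E_def)
  then show "\<exists>W. open W \<and> x \<in> W \<and> smooth_on W (\<lambda>x. \<phi> (E x))"
    using op x by (intro exI[of _ "Q \<inter> E -` U"]) (auto simp: Q_def mem_box_cart)
qed

lemma continuous_on_angle_map: "continuous_on UNIV (angle_map \<zeta>)"
  using smooth_map_angle_map by (simp add: smooth_map_def)

text \<open>Since \<open>E\<close> is a covering, it can be inverted only locally. Near
  \<open>E x\<close> the inverse is the angle map read in the torus chart centred at x; this choice
  of branch makes the section return to the prescribed point x.\<close>

lemma local_section:
  assumes U: "(U, \<phi>) \<in> A" and x: "E x \<in> U"
  obtains W \<gamma> where "open W" "\<phi> (E x) \<in> W" "W \<subseteq> \<phi> ` U" "smooth_on W \<gamma>" "\<gamma> (\<phi> (E x)) = x"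
    "\<And>y. y \<in> W \<Longrightarrow> E (\<gamma> y) = inv_into U \<phi> y"
proof -
  define Q where "Q = box (x - (\<chi> i. pi)) (x + (\<chi> i. pi))"
  define V where "V = torus_exp ` Q"
  define \<psi> where "\<psi> = inv_into Q torus_exp"
  define W where "W = \<phi> ` (U \<inter> angle_map \<zeta> -` V)"
  have inj: "inj_on torus_exp Q" unfolding Q_def by (rule inj_on_torus_exp_box)
  have psi: "\<psi> (torus_exp y) = y" if "y \<in> Q" for y
    using inj that by (simp add: \<psi>_def)
  have "(V, \<psi>) \<in> torus_atlas"
    unfolding V_def \<psi>_def Q_def by (rule torus_atlas_box)
  then have sm: "smooth_on W (\<psi> \<circ> angle_map \<zeta> \<circ> inv_into U \<phi>)"
    using smooth_map_angle_map U unfolding smooth_map_def W_def by fast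
  have "angle_map \<zeta> -` V = (\<Inter>i. {p. angle_map \<zeta> p $ i \<noteq> - cis (x $ i)})"
    using bij unfolding V_def Q_def torus_exp_box by (auto simp: bij_betw_def)
  moreover have "open {p. angle_map \<zeta> p $ i \<noteq> - cis (x $ i)}" for i
    by (intro open_Collect_neq continuous_intros continuous_on_component continuous_on_angle_map)
  ultimately have "open (angle_map \<zeta> -` V)" by (auto intro!: open_INT)
  then have oW: "open W"
    unfolding W_def using open_chart_domain[OF U] by (intro open_chart_image_subset[OF U]) auto
  have xQ: "x \<in> Q" by (simp add: Q_def mem_box_cart)
  show thesis
  proof (rule that[of W "\<psi> \<circ> angle_map \<zeta> \<circ> inv_into U \<phi>"])
    show "\<phi> (E x) \<in> W" using x xQ by (auto simp: W_def V_def)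
    show "(\<psi> \<circ> angle_map \<zeta> \<circ> inv_into U \<phi>) (\<phi> (E x)) = x"
      by (simp add: chart_inverse[OF U x] psi xQ)
    fix y assume "y \<in> W"
    then obtain p where p: "p \<in> U" "angle_map \<zeta> p \<in> V" "y = \<phi> p" by (auto simp: W_def)
    then obtain z where z: "z \<in> Q" "angle_map \<zeta> p = torus_exp z" by (auto simp: V_def)
    then have "E z = p"
      by (intro E_eqI) (simp add: angle_map_def torus_exp_def vec_eq_iff)
    then show "E ((\<psi> \<circ> angle_map \<zeta> \<circ> inv_into U \<phi>) y) = inv_into U \<phi> y"
      using p z by (simp add: chart_inverse[OF U] psi)
  qed (use oW sm in \<open>auto simp: W_def\<close>)
qed

text \<open>Replaces all charts by one function on \<real>^m. One direction composes the chart
  expression with \<open>E\<close>, the other composes the pulled-back function with the local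
  sections of \<open>E\<close>.\<close>

lemma smooth_fun_iff: "smooth_fun A f \<longleftrightarrow> smooth_on UNIV (\<lambda>x. f (E x))"
proof
  assume f: "smooth_fun A f"
  show "smooth_on UNIV (\<lambda>x. f (E x))"
  proof (rule smooth_on_local)
    fix x
    obtain U \<phi> where U: "(U, \<phi>) \<in> A" "E x \<in> U" using chart_exists by blast
    have "smooth_on (\<phi> ` U) (f \<circ> inv_into U \<phi>)"
      using smooth_funD[OF f U(1)] by (simp add: o_def)
    then have "smooth_on (E -` U) (\<lambda>x. (f \<circ> inv_into U \<phi>) (\<phi> (E x)))"
      by (intro smooth_on_compose[of _ "\<phi> ` U" "\<lambda>x. \<phi> (E x)" "f \<circ> inv_into U \<phi>"]
          open_vimage_E open_chart_domain[OF U(1)] open_chart_image[OF U(1)] smooth_on_chart_E[OF U(1)])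
        auto
    then have "smooth_on (E -` U) (\<lambda>x. f (E x))"
      by (rule smooth_on_cong)
        (auto simp: chart_inverse[OF U(1)] open_vimage_E open_chart_domain[OF U(1)])
    then show "\<exists>W. open W \<and> x \<in> W \<and> smooth_on W (\<lambda>x. f (E x))"
      using U open_vimage_E[OF open_chart_domain[OF U(1)]] by (intro exI[of _ "E -` U"]) auto
  qed
next
  assume f: "smooth_on UNIV (\<lambda>x. f (E x))"
  show "smooth_fun A f"
    unfolding smooth_fun_def
  proof (clarify, rule smooth_on_local)
    fix U \<phi> y assume U: "(U, \<phi>) \<in> A" and "y \<in> \<phi> ` U"
    then obtain p where p: "p \<in> U" "y = \<phi> p" by blast
    obtain x where x: "p = E x" using E_surj by blast
    from local_section[OF U, of x] p x obtain W \<gamma> where W: "open W" "y \<in> W" "W \<subseteq> \<phi> ` U"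
      "smooth_on W \<gamma>" "\<And>y. y \<in> W \<Longrightarrow> E (\<gamma> y) = inv_into U \<phi> y" by metis
    have "smooth_on W (\<lambda>y. f (E (\<gamma> y)))"
      using W f smooth_on_compose[of W UNIV \<gamma> "\<lambda>x. f (E x)"] by auto
    then have "smooth_on W (f \<circ> inv_into U \<phi>)"
      by (rule smooth_on_cong) (use W in auto)
    then show "\<exists>W. open W \<and> y \<in> W \<and> smooth_on W (f \<circ> inv_into U \<phi>)"
      using W by blast
  qed
qed

lemma differentiable_E: "smooth_fun A f \<Longrightarrow> (\<lambda>x. f (E x)) differentiable (at x)"
  by (simp add: smooth_fun_iff smooth_on_imp_differentiable)

text \<open>The arguments are reordered so that the partial derivative in the i-th angle maps
  functions to functions and can be iterated.\<close>

definition der :: "'m \<Rightarrow> ('a \<Rightarrow> real) \<Rightarrow> 'a \<Rightarrow> real" where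
  "der i f p = angle_field A \<zeta> i p f"


end

section \<open>Tangent vectors in the angle frame\<close>

context torus_coordinates
begin

text \<open>Multiplying the i-th eigenfunction value by \<open>cis t\<close> shifts the i-th angle
  by t, so the coordinate curves are images of straight lines.\<close>

lemma angle_field_E: "angle_field A \<zeta> i (E x) = velocity A (\<lambda>t. E (x + t *\<^sub>R axis i 1))"
proof -
  have "(\<chi> j. if j = i then cis t * \<zeta> j (E x) else \<zeta> j (E x)) = torus_exp (x + t *\<^sub>R axis i 1)" for t
    by (auto simp: vec_eq_iff torus_exp_def cis_mult axis_def add.commute)
  then show ?thesis by (simp add: angle_field_def E_def[symmetric])
qed

lemma velocity_line:
  assumes "smooth_fun A f"
  shows "velocity A (\<lambda>t. E (x + t *\<^sub>R a)) f = frechet_derivative (\<lambda>y. f (E y)) (at x) a"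
  using DERIV_along_line[of "\<lambda>y. f (E y)" x 0 a] differentiable_E[OF assms, of x] assms
  by (simp add: velocity_def has_real_derivative_iff_has_vector_derivative vector_derivative_at)

lemma der_E:
  "smooth_fun A f \<Longrightarrow> der i f (E x) = frechet_derivative (\<lambda>y. f (E y)) (at x) (axis i 1)"
  by (simp add: der_def angle_field_E velocity_line)

lemma der_nonsmooth: "\<not> smooth_fun A f \<Longrightarrow> der i f p = 0"
  by (simp add: der_def angle_field_def velocity_def)

lemma smooth_fun_der: "smooth_fun A f \<Longrightarrow> smooth_fun A (der i f)"
  by (simp add: smooth_fun_iff[of "der i f"] der_E)
    (simp add: smooth_fun_iff smooth_on_frechet_derivative)

lemma has_derivative_E:
  "smooth_fun A f \<Longrightarrow> ((\<lambda>y. f (E y)) has_derivative frechet_derivative (\<lambda>y. f (E y)) (at x)) (at x)"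
  using differentiable_E frechet_derivative_works by blast

lemma der_add:
  assumes "smooth_fun A f" "smooth_fun A g"
  shows "der i (\<lambda>p. f p + g p) p = der i f p + der i g p"
proof -
  obtain x where "p = E x" using E_surj by blast
  then show ?thesis
    using has_derivative_add[OF has_derivative_E[OF assms(1), of x] has_derivative_E[OF assms(2), of x]]
    by (simp add: der_E assms smooth_fun_add frechet_derivative_at[symmetric])
qed

lemma der_mult:
  assumes "smooth_fun A f" "smooth_fun A g"
  shows "der i (\<lambda>p. f p * g p) p = der i f p * g p + f p * der i g p"
proof -
  obtain x where "p = E x" using E_surj by blast
  then show ?thesis
    using has_derivative_mult[OF has_derivative_E[OF assms(1), of x] has_derivative_E[OF assms(2), of x]]
    by (simp add: der_E assms smooth_fun_mult frechet_derivative_at[symmetric])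
qed

lemma der_const [simp]: "der i (\<lambda>p. c) p = 0"
proof -
  obtain x where "p = E x" using E_surj by blast
  then show ?thesis by (simp add: der_E)
qed

lemma der_cmult: "smooth_fun A f \<Longrightarrow> der i (\<lambda>p. c * f p) p = c * der i f p"
  by (simp add: der_mult)

lemma der_sum:
  "(\<And>j. j \<in> J \<Longrightarrow> smooth_fun A (f j)) \<Longrightarrow> der i (\<lambda>p. \<Sum>j\<in>J. f j p) p = (\<Sum>j\<in>J. der i (f j) p)"
  by (induction J rule: infinite_finite_induct) (auto simp: der_add smooth_fun_sum)

lemma der_commute: "smooth_fun A f \<Longrightarrow> der i (der j f) p = der j (der i f) p"
proof -
  assume f: "smooth_fun A f"
  obtain x where "p = E x" using E_surj by blast
  then show ?thesis
    using f frechet_derivative_commute[of "\<lambda>x. f (E x)"]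
    by (simp add: der_E smooth_fun_der) (simp add: der_E smooth_fun_iff)
qed

lemma sum_der_E:
  assumes "smooth_fun A f"
  shows "(\<Sum>i\<in>UNIV. a $ i * der i f (E x)) = frechet_derivative (\<lambda>y. f (E y)) (at x) a"
proof -
  interpret D: linear "frechet_derivative (\<lambda>y. f (E y)) (at x)"
    using differentiable_E[OF assms] by (rule linear_frechet_derivative)
  have "frechet_derivative (\<lambda>y. f (E y)) (at x) a
      = frechet_derivative (\<lambda>y. f (E y)) (at x) (\<Sum>i\<in>UNIV. a $ i *\<^sub>R axis i 1)"
    using basis_expansion[of a] by (simp add: scalar_mult_eq_scaleR)
  then show ?thesis by (simp add: D.sum D.scale der_E[OF assms])
qed

definition tvec :: "real^'m \<Rightarrow> 'a \<Rightarrow> 'a tangent" where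
  "tvec a p = (\<lambda>f. \<Sum>i\<in>UNIV. a $ i * der i f p)"

lemma tvec_nonsmooth: "\<not> smooth_fun A f \<Longrightarrow> tvec a p f = 0"
  by (simp add: tvec_def der_nonsmooth)

lemma tvec_E: "tvec a (E x) = velocity A (\<lambda>t. E (x + t *\<^sub>R a))"
proof
  fix f
  show "tvec a (E x) f = velocity A (\<lambda>t. E (x + t *\<^sub>R a)) f"
    by (cases "smooth_fun A f")
      (simp_all add: velocity_line tvec_nonsmooth, simp_all add: velocity_def tvec_def sum_der_E)
qed

lemma angle_field_eq_tvec: "angle_field A \<zeta> i p = tvec (axis i 1) p"
proof -
  obtain x where "p = E x" using E_surj by blast
  then show ?thesis by (simp add: angle_field_E tvec_E)
qed

lemma tvec_in_tangent_space: "tvec a p \<in> tangent_space A p"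
proof -
  obtain x where x: "p = E x" using E_surj by blast
  define c where "c t = E (x + t *\<^sub>R a)" for t
  have cont: "continuous_on S c" for S
    unfolding c_def by (intro continuous_on_compose2[OF continuous_on_E[of UNIV]] continuous_intros) auto
  have "smooth_on ({-1<..<1} \<inter> c -` V) (\<psi> \<circ> c \<circ> inv_into {-1<..<1} (\<lambda>t. t))"
    if V: "(V, \<psi>) \<in> A" for V \<psi>
  proof -
    have op: "open ({-1<..<1} \<inter> c -` V)"
      using cont[of UNIV] open_chart_domain[OF V] by (auto intro!: open_Int open_vimage)
    have "smooth_on UNIV (\<lambda>t. x + t *\<^sub>R a)"
      by (rule smooth_on_add[OF open_UNIV smooth_on_const smooth_on_linear[OF bounded_linear_scaleR_left]])
    from smooth_on_subset[OF this subset_UNIV]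
    have "smooth_on ({-1<..<1} \<inter> c -` V) (\<lambda>t. \<psi> (E (x + t *\<^sub>R a)))"
      using open_chart_domain[OF V]
      by (intro smooth_on_compose[OF op _ _ smooth_on_chart_E[OF V]]) (auto simp: open_vimage_E c_def)
    then show ?thesis
      by (rule smooth_on_cong[OF _ op]) (auto simp: c_def inv_into_f_f[of "\<lambda>t. t"])
  qed
  then have "smooth_map {-1<..<1} {({-1<..<1}, \<lambda>t::real. t)} UNIV A c"
    using cont unfolding smooth_map_def by auto
  moreover have "tvec a p = velocity A c" "c 0 = p"
    by (simp_all add: x tvec_E c_def[abs_def])
  ultimately show ?thesis
    unfolding tangent_space_def by (auto intro!: exI[of _ c] exI[of _ 1])
qed

text \<open>Near time 0 the curve lifts through a local section of \<open>E\<close>, and the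
  coefficient vector is the velocity of the lift in \<real>^m. This is the nontrivial half of the
  description of the tangent space.\<close>

lemma velocity_eq_tvec:
  assumes e: "e > 0" and c: "smooth_map {-e<..<e} {({-e<..<e}, \<lambda>t::real. t)} UNIV A c"
  shows "\<exists>a. velocity A c = tvec a (c 0)"
proof -
  obtain x where x: "c 0 = E x" using E_surj by blast
  obtain U \<phi> where U: "(U, \<phi>) \<in> A" "E x \<in> U" using chart_exists by blast
  obtain W \<gamma> where W: "open W" "\<phi> (E x) \<in> W" "W \<subseteq> \<phi> ` U" "smooth_on W \<gamma>" "\<gamma> (\<phi> (E x)) = x"
    "\<And>y. y \<in> W \<Longrightarrow> E (\<gamma> y) = inv_into U \<phi> y"
    using local_section[OF U] by metis
  define T where "T = {-e<..<e} \<inter> c -` U"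
  have "continuous_on {-e<..<e} c" using c by (simp add: smooth_map_def)
  then have oT: "open T"
    unfolding T_def using continuous_open_preimage[OF _ open_greaterThanLessThan open_chart_domain[OF U(1)]]
    by blast
  have "smooth_on ((\<lambda>t. t) ` T) (\<phi> \<circ> c \<circ> inv_into {-e<..<e} (\<lambda>t. t))"
    using c U(1) unfolding smooth_map_def T_def by (auto dest!: bspec[of A _ "(U, \<phi>)"])
  then have sm: "smooth_on T (\<lambda>t. \<phi> (c t))"
    unfolding image_ident
    by (rule smooth_on_cong[OF _ oT]) (auto simp: T_def inv_into_f_f[of "\<lambda>t. t"])
  define T' where "T' = (\<lambda>t. \<phi> (c t)) -` W \<inter> T"
  have oT': "open T'"
    using continuous_open_preimage[OF smooth_on_imp_continuous_on[OF sm] oT W(1)]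
    by (simp add: T'_def Int_commute)
  have T0: "0 \<in> T'" using e x U W by (simp add: T'_def T_def)
  have lift: "E (\<gamma> (\<phi> (c t))) = c t" if "t \<in> T'" for t
    using that W(6) chart_inverse[OF U(1)] by (simp add: T'_def T_def)
  have "smooth_on T' (\<lambda>t. \<gamma> (\<phi> (c t)))"
    by (rule smooth_on_compose[OF oT' W(1) smooth_on_subset[OF sm] W(4)]) (auto simp: T'_def)
  from smooth_on_imp_differentiable[OF this T0]
  obtain a where a: "((\<lambda>t. \<gamma> (\<phi> (c t))) has_vector_derivative a) (at 0)"
    using vector_derivative_works by blast
  have "velocity A c f = tvec a (c 0) f" for f
  proof (cases "smooth_fun A f")
    case True
    have "((\<lambda>y. f (E y)) has_derivative frechet_derivative (\<lambda>y. f (E y)) (at x)) (at (\<gamma> (\<phi> (c 0))))"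
      using has_derivative_E[OF True, of x] x W(5) by simp
    then have "(((\<lambda>y. f (E y)) \<circ> (\<lambda>t. \<gamma> (\<phi> (c t)))) has_vector_derivative
        frechet_derivative (\<lambda>y. f (E y)) (at x) a) (at 0)"
      by (intro vector_derivative_diff_chain_within[OF a]) (auto intro: has_derivative_at_withinI)
    then have "((\<lambda>t. f (c t)) has_vector_derivative frechet_derivative (\<lambda>y. f (E y)) (at x) a) (at 0)"
      by (rule has_vector_derivative_transform_within_open[OF _ oT' T0]) (simp add: lift)
    then show ?thesis
      using True by (simp add: velocity_def vector_derivative_at tvec_def x sum_der_E)
  qed (simp add: velocity_def tvec_nonsmooth)
  then show ?thesis by blast
qed

lemma tangent_space_eq: "tangent_space A p = range (\<lambda>a. tvec a p)"
proof
  show "tangent_space A p \<subseteq> range (\<lambda>a. tvec a p)"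
  proof
    fix u assume "u \<in> tangent_space A p"
    then obtain c e where "u = velocity A c" "c 0 = p" "e > 0"
      "smooth_map {-e<..<e} {({-e<..<e}, \<lambda>t::real. t)} UNIV A c"
      unfolding tangent_space_def by blast
    with velocity_eq_tvec[of e c] show "u \<in> range (\<lambda>a. tvec a p)" by auto
  qed
qed (auto intro: tvec_in_tangent_space)

lemma tangent_nonsmooth: "u \<in> tangent_space A p \<Longrightarrow> \<not> smooth_fun A f \<Longrightarrow> u f = 0"
  by (auto simp: tangent_space_eq tvec_nonsmooth)

lemma tangent_add:
  "u \<in> tangent_space A p \<Longrightarrow> smooth_fun A f \<Longrightarrow> smooth_fun A g \<Longrightarrow> u (\<lambda>q. f q + g q) = u f + u g"
  by (auto simp: tangent_space_eq tvec_def der_add algebra_simps sum.distrib)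

lemma tangent_mult:
  "u \<in> tangent_space A p \<Longrightarrow> smooth_fun A f \<Longrightarrow> smooth_fun A g \<Longrightarrow>
    u (\<lambda>q. f q * g q) = u f * g p + f p * u g"
  by (auto simp: tangent_space_eq tvec_def der_mult algebra_simps sum.distrib sum_distrib_left)

lemma tangent_const [simp]: "u \<in> tangent_space A p \<Longrightarrow> u (\<lambda>q. c) = 0"
  by (auto simp: tangent_space_eq tvec_def)

lemma tangent_cmult:
  "u \<in> tangent_space A p \<Longrightarrow> smooth_fun A f \<Longrightarrow> u (\<lambda>q. c * f q) = c * u f"
  using tangent_mult[of u p "\<lambda>q. c" f] by simp

lemma tangent_sum:
  "u \<in> tangent_space A p \<Longrightarrow> (\<And>j. j \<in> J \<Longrightarrow> smooth_fun A (f j)) \<Longrightarrow>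
    u (\<lambda>q. \<Sum>j\<in>J. f j q) = (\<Sum>j\<in>J. u (f j))"
  by (induction J rule: infinite_finite_induct) (auto simp: tangent_add[of u p] smooth_fun_sum)

lemma smooth_field_tvec:
  assumes "\<And>i. smooth_fun A (\<lambda>p. a p $ i)"
  shows "smooth_field A (\<lambda>p. tvec (a p) p)"
  unfolding smooth_field_def
proof (intro conjI allI impI)
  fix f :: "'a \<Rightarrow> real" assume "smooth_fun A f"
  then show "smooth_fun A (\<lambda>p. tvec (a p) p f)"
    unfolding tvec_def by (intro smooth_fun_sum smooth_fun_mult assms smooth_fun_der)
qed (rule tvec_in_tangent_space)

lemma smooth_fieldD: "smooth_field A X \<Longrightarrow> X p \<in> tangent_space A p"
  and smooth_field_smooth: "smooth_field A X \<Longrightarrow> smooth_fun A f \<Longrightarrow> smooth_fun A (\<lambda>p. X p f)"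
  by (auto simp: smooth_field_def)

end

section \<open>Positive definite matrices\<close>

lemma symmetric_matrix_inner:
  fixes C :: "real^'n^'n"
  assumes "transpose C = C"
  shows "x \<bullet> (C *v y) = (C *v x) \<bullet> y"
  by (metis assms dot_lmul_matrix transpose_matrix_vector)

lemma matrix_inv_mult:
  assumes "invertible C"
  shows "C ** matrix_inv C = mat 1" "matrix_inv C ** C = mat 1"
  using someI_ex[OF assms[unfolded invertible_def]] by (auto simp: matrix_inv_def)

lemma invertible_pos_def:
  fixes C :: "real^'n^'n"
  assumes "\<And>x. x \<noteq> 0 \<Longrightarrow> x \<bullet> (C *v x) > 0"
  shows "invertible C"
proof -
  have "inj ((*v) C)"
    using assms by (intro injI) (metis inner_zero_right less_irrefl matrix_vector_mult_diff_distrib right_minus_eq)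
  then show ?thesis
    by (simp add: invertible_left_inverse matrix_left_invertible_injective)
qed

text \<open>Gram-Schmidt without projections: a nonzero vector that is Euclidean-orthogonal to all
  \<open>C *v e i\<close> found so far is C-orthogonal to the \<open>e i\<close>, and it exists
  because fewer vectors than the dimension cannot span the space.\<close>

lemma pos_def_orthonormal_basis:
  fixes C :: "real^'n^'n"
  assumes sym: "transpose C = C" and pd: "\<And>x. x \<noteq> 0 \<Longrightarrow> x \<bullet> (C *v x) > 0"
  shows "\<exists>e :: 'n \<Rightarrow> real^'n. \<forall>i j. e i \<bullet> (C *v e j) = (if i = j then 1 else 0)"
proof -
  have "\<exists>e :: 'n \<Rightarrow> real^'n. \<forall>i\<in>I. \<forall>j\<in>I. e i \<bullet> (C *v e j) = (if i = j then 1 else 0)" for I :: "'n set"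
    using finite[of I]
  proof (induction I rule: finite_induct)
    case (insert k I)
    then obtain e :: "'n \<Rightarrow> real^'n"
      where e: "\<And>i j. i \<in> I \<Longrightarrow> j \<in> I \<Longrightarrow> e i \<bullet> (C *v e j) = (if i = j then 1 else 0)" by blast
    have "dim ((\<lambda>i. C *v e i) ` I) \<le> card I"
      by (meson card_image_le dim_le_card' dual_order.trans finite finite_imageI)
    also have "card I < CARD('n)"
      using insert.hyps by (intro psubset_card_mono) auto
    finally have "dim ((\<lambda>i. C *v e i) ` I) < DIM(real^'n)" by simp
    then obtain w where w: "w \<noteq> 0" "\<And>y. y \<in> span ((\<lambda>i. C *v e i) ` I) \<Longrightarrow> orthogonal w y"
      using orthogonal_to_subspace_exists by blast
    define c where "c = sqrt (w \<bullet> (C *v w))"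
    have c: "c > 0" "c * c = w \<bullet> (C *v w)"
      using pd[OF w(1)] by (auto simp: c_def)
    define u where "u = (1 / c) *\<^sub>R w"
    have u1: "u \<bullet> (C *v u) = 1"
      using c(1) by (simp add: u_def matrix_vector_mult_scaleR c(2)[symmetric])
    have u2: "u \<bullet> (C *v e i) = 0" if "i \<in> I" for i
      using w(2)[of "C *v e i"] that by (simp add: u_def orthogonal_def span_base)
    have u3: "e i \<bullet> (C *v u) = 0" if "i \<in> I" for i
      using u2[OF that] symmetric_matrix_inner[OF sym, of "e i" u] by (simp add: inner_commute)
    show ?case
      using insert.hyps by (intro exI[of _ "e(k := u)"]) (auto simp: e u1 u2 u3)
  qed simp
  from this[of UNIV] show ?thesis by simp
qed

text \<open>If P has the columns \<open>e i\<close>, then C-orthonormality reads P^T C P = 1.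
  One-sided inverses of square matrices are two-sided, so P P^T C = 1, and cyclicity of the trace
  makes the basis disappear.\<close>

lemma trace_orthonormal_basis:
  fixes C J :: "real^'n^'n" and e :: "'n \<Rightarrow> real^'n"
  assumes sym: "transpose C = C" and e: "\<And>i j. e i \<bullet> (C *v e j) = (if i = j then 1 else 0)"
  shows "(\<Sum>i\<in>UNIV. (J *v e i) \<bullet> (C *v e i)) = trace J"
proof -
  define P :: "real^'n^'n" where "P = (\<chi> k i. e i $ k)"
  have mv: "(N ** P) $ k $ i = (N *v e i) $ k" for N :: "real^'n^'n" and k i
    by (simp add: matrix_matrix_mult_def matrix_vector_mult_def P_def)
  have tp: "transpose P $ i $ k = e i $ k" for i k
    by (simp add: P_def transpose_def)
  have "(transpose P ** (C ** P)) $ i $ j = (\<Sum>k\<in>UNIV. transpose P $ i $ k * (C ** P) $ k $ j)" for i j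
    by (simp add: matrix_matrix_mult_def)
  then have "transpose P ** (C ** P) = mat 1"
    using e by (simp add: vec_eq_iff mv tp mat_def inner_vec_def)
  then have inv: "P ** (transpose P ** C) = mat 1"
    by (metis matrix_left_right_inverse matrix_mul_assoc)
  have "(transpose (C ** P) ** (J ** P)) $ i $ i = (\<Sum>k\<in>UNIV. (C ** P) $ k $ i * (J ** P) $ k $ i)" for i
  proof -
    have "(N ** L) $ i $ i = (\<Sum>k\<in>UNIV. N $ i $ k * L $ k $ i)" for N L :: "real^'n^'n"
      by (simp add: matrix_matrix_mult_def)
    then show ?thesis by (simp add: transpose_def)
  qed
  then have "(\<Sum>i\<in>UNIV. (J *v e i) \<bullet> (C *v e i)) = trace (transpose (C ** P) ** (J ** P))"
    by (simp add: trace_def mv inner_vec_def mult.commute)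
  also have "\<dots> = trace ((J ** P) ** transpose (C ** P))" by (rule trace_mul_sym)
  also have "transpose (C ** P) = transpose P ** C" by (simp add: matrix_transpose_mul sym)
  also have "trace ((J ** P) ** (transpose P ** C)) = trace J"
    by (simp add: inv matrix_mul_assoc[symmetric])
  finally show ?thesis .
qed

section \<open>Metrics with constant coefficients in angle coordinates\<close>

text \<open>The forms here are dual to the coordinate fields rather than to the \<open>v i\<close>,
  which keeps the frequencies out of the geometry until the final rescaling.\<close>

locale angle_coframe = torus_coordinates A \<zeta>
  for A :: "('a::{second_countable_topology, t2_space}, real^'m) chart set" and \<zeta> +
  fixes \<tau> :: "'m \<Rightarrow> 'a oneform"
  assumes oneform: "\<And>i. smooth_oneform A (\<tau> i)"
    and dual: "\<And>i j p. \<tau> i p (angle_field A \<zeta> j p) = (if i = j then 1 else 0)"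
begin

lemma tau_lincomb:
  "u \<in> tangent_space A p \<Longrightarrow> w \<in> tangent_space A p \<Longrightarrow>
    \<tau> i p (\<lambda>f. a * u f + b * w f) = a * \<tau> i p u + b * \<tau> i p w"
  using oneform unfolding smooth_oneform_def by blast

lemma smooth_fun_tau: "smooth_field A X \<Longrightarrow> smooth_fun A (\<lambda>p. \<tau> i p (X p))"
  using oneform unfolding smooth_oneform_def by blast

text \<open>\<open>smooth_oneform\<close> gives linearity for two-term combinations, so the
  coordinates are switched on one at a time, by induction on the set \<open>J\<close> of those
  kept.\<close>

lemma tau_tvec [simp]: "\<tau> i p (tvec a p) = a $ i"
proof -
  have "\<tau> i p (tvec (\<chi> j. if j \<in> J then a $ j else 0) p) = (if i \<in> J then a $ i else 0)" for J :: "'m set"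
    using finite[of J]
  proof (induction J rule: finite_induct)
    case empty
    \<comment> \<open>The zero vector is written as a combination with both coefficients 0, so that
      linearity determines the value of the form on it.\<close>
    have "tvec (\<chi> j. if j \<in> {} then a $ j else 0) p = (\<lambda>f. 0 * tvec a p f + 0 * tvec a p f)"
      by (simp add: tvec_def)
    then show ?case
      using tau_lincomb[OF tvec_in_tangent_space[of a p] tvec_in_tangent_space[of a p], of i 0 0] by simp
  next
    case (insert k J)
    have "tvec (\<chi> j. if j \<in> insert k J then a $ j else 0) p
        = (\<lambda>f. a $ k * angle_field A \<zeta> k p f + 1 * tvec (\<chi> j. if j \<in> J then a $ j else 0) p f)"
    proof
      fix f
      have "(\<Sum>j\<in>UNIV. (if j = k \<or> j \<in> J then a $ j else 0) * der j f p)
          = (\<Sum>j\<in>UNIV. (if j = k then a $ k * der k f p else 0)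
              + (if j \<in> J then a $ j else 0) * der j f p)"
        using insert.hyps by (intro sum.cong) auto
      then show "tvec (\<chi> j. if j \<in> insert k J then a $ j else 0) p f
        = a $ k * angle_field A \<zeta> k p f + 1 * tvec (\<chi> j. if j \<in> J then a $ j else 0) p f"
        by (simp add: tvec_def sum.distrib der_def)
    qed
    moreover have "angle_field A \<zeta> k p \<in> tangent_space A p"
      by (simp add: angle_field_eq_tvec tvec_in_tangent_space)
    ultimately show ?case
      using insert tau_lincomb[OF _ tvec_in_tangent_space, of "angle_field A \<zeta> k p" p i "a $ k" 1]
      by (auto simp: dual)
  qed
  from this[of UNIV] show ?thesis by simp
qed

lemma tangent_eq_tvec: "u \<in> tangent_space A p \<Longrightarrow> u = tvec (\<chi> i. \<tau> i p u) p"
  by (auto simp: tangent_space_eq)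

lemma tangent_eqI:
  "u \<in> tangent_space A p \<Longrightarrow> w \<in> tangent_space A p \<Longrightarrow> (\<And>i. \<tau> i p u = \<tau> i p w) \<Longrightarrow> u = w"
  using tangent_eq_tvec[of u p] tangent_eq_tvec[of w p] by simp

lemma tau_sum_der: "u \<in> tangent_space A p \<Longrightarrow> u f = (\<Sum>i\<in>UNIV. \<tau> i p u * der i f p)"
  using arg_cong[OF tangent_eq_tvec[of u p], of "\<lambda>u. u f"] by (simp add: tvec_def)

end

locale constant_metric = angle_coframe A \<zeta> \<tau>
  for A :: "('a::{second_countable_topology, t2_space}, real^'m) chart set" and \<zeta> \<tau> +
  fixes C :: "real^'m^'m"
  assumes sym: "transpose C = C"
    and pos_def: "\<And>x. x \<noteq> 0 \<Longrightarrow> x \<bullet> (C *v x) > 0"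
begin

definition metric :: "'a metric_tensor" where
  "metric p u w = (\<Sum>i\<in>UNIV. \<Sum>j\<in>UNIV. C $ i $ j * \<tau> i p u * \<tau> j p w)"

lemma metric_eq_inner: "metric p u w = (\<chi> i. \<tau> i p u) \<bullet> (C *v (\<chi> i. \<tau> i p w))"
  by (simp add: metric_def inner_vec_def matrix_vector_mult_def sum_distrib_left mult_ac)

lemma metric_tvec: "metric p (tvec a p) (tvec b p) = a \<bullet> (C *v b)"
  by (simp add: metric_eq_inner)

lemma metric_sym: "metric p u w = metric p w u"
  unfolding metric_eq_inner
  by (subst symmetric_matrix_inner[OF sym]) (rule inner_commute)

lemma smooth_field_angle: "smooth_field A (\<lambda>p. tvec a p)"
  by (rule smooth_field_tvec) simp

subsection \<open>The Levi-Civita connection\<close>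

text \<open>Differentiates the angle components of Y along X, so that the coordinate fields are
  parallel.\<close>

definition flat_connection :: "'a vfield \<Rightarrow> 'a vfield \<Rightarrow> 'a vfield" where
  "flat_connection X Y p = tvec (\<chi> j. X p (\<lambda>q. \<tau> j q (Y q))) p"

lemma tau_field_add:
  "smooth_field A Y \<Longrightarrow> smooth_field A Z \<Longrightarrow> \<tau> i p (field_add Y Z p) = \<tau> i p (Y p) + \<tau> i p (Z p)"
  using tau_lincomb[OF smooth_fieldD smooth_fieldD, of Y Z i p 1 1] by (simp add: field_add_def)

lemma tau_field_scale:
  "smooth_field A Z \<Longrightarrow> \<tau> i p (field_scale h Z p) = h p * \<tau> i p (Z p)"
  using tau_lincomb[OF smooth_fieldD smooth_fieldD, of Z Z i p "h p" 0] by (simp add: field_scale_def)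

lemma affine_flat_connection: "affine_connection A flat_connection"
  unfolding affine_connection_def
proof (intro conjI allI impI)
  fix X Y assume "smooth_field A X \<and> smooth_field A Y"
  then show "smooth_field A (flat_connection X Y)"
    unfolding flat_connection_def[abs_def]
    by (intro smooth_field_tvec) (simp add: smooth_field_smooth smooth_fun_tau)
next
  fix X Y Z h
  assume *: "smooth_field A X \<and> smooth_field A Y \<and> smooth_field A Z \<and> smooth_fun A (h :: 'a \<Rightarrow> real)"
  have Xp: "X p \<in> tangent_space A p" for p
    using * by (simp add: smooth_fieldD)
  show "flat_connection (field_add X Y) Z = field_add (flat_connection X Z) (flat_connection Y Z)"
    by (simp add: fun_eq_iff flat_connection_def tvec_def field_add_def distrib_right sum.distrib)
  show "flat_connection (field_scale h X) Z = field_scale h (flat_connection X Z)"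
    by (simp add: fun_eq_iff flat_connection_def tvec_def field_scale_def sum_distrib_left mult_ac)
  show "flat_connection X (field_add Y Z) = field_add (flat_connection X Y) (flat_connection X Z)"
  proof (intro ext)
    fix p f
    have "X p (\<lambda>q. \<tau> j q (field_add Y Z q)) = X p (\<lambda>q. \<tau> j q (Y q)) + X p (\<lambda>q. \<tau> j q (Z q))" for j
      using * by (simp add: tau_field_add tangent_add[OF Xp] smooth_fun_tau)
    then show "flat_connection X (field_add Y Z) p f
        = field_add (flat_connection X Y) (flat_connection X Z) p f"
      by (simp add: flat_connection_def tvec_def field_add_def distrib_right sum.distrib)
  qed
  show "flat_connection X (field_scale h Z)
      = field_add (field_scale h (flat_connection X Z)) (field_scale (\<lambda>p. X p h) Z)"
  proof (intro ext)
    fix p f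
    have "X p (\<lambda>q. \<tau> j q (field_scale h Z q))
        = X p h * \<tau> j p (Z p) + h p * X p (\<lambda>q. \<tau> j q (Z q))" for j
      using * by (simp add: tau_field_scale tangent_mult[OF Xp] smooth_fun_tau)
    moreover have "Z p f = (\<Sum>i\<in>UNIV. \<tau> i p (Z p) * der i f p)"
      using * by (intro tau_sum_der smooth_fieldD) auto
    ultimately show "flat_connection X (field_scale h Z) p f
        = field_add (field_scale h (flat_connection X Z)) (field_scale (\<lambda>p. X p h) Z) p f"
      by (simp add: flat_connection_def tvec_def field_add_def field_scale_def algebra_simps
          sum.distrib sum_distrib_left)
  qed
qed

text \<open>Splits the iterated derivative into the flat connection and a second-order part. The
  latter is symmetric in X and Y once derivatives commute, hence cancels in the Lie bracket.\<close>

lemma field_field_der: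
  assumes X: "smooth_field A X" and Y: "smooth_field A Y" and f: "smooth_fun A f"
  shows "X p (\<lambda>q. Y q f) = (\<Sum>j\<in>UNIV. X p (\<lambda>q. \<tau> j q (Y q)) * der j f p)
    + (\<Sum>i\<in>UNIV. \<Sum>j\<in>UNIV. \<tau> i p (X p) * \<tau> j p (Y p) * der i (der j f) p)"
proof -
  note Xp = smooth_fieldD[OF X, of p]
  have "X p (\<lambda>q. Y q f) = X p (\<lambda>q. \<Sum>j\<in>UNIV. \<tau> j q (Y q) * der j f q)"
    by (rule arg_cong[of _ _ "X p"]) (auto simp: tau_sum_der[OF smooth_fieldD[OF Y]])
  also have "\<dots> = (\<Sum>j\<in>UNIV. X p (\<lambda>q. \<tau> j q (Y q)) * der j f p + \<tau> j p (Y p) * X p (der j f))"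
    by (simp add: tangent_sum[OF Xp] tangent_mult[OF Xp] smooth_fun_mult smooth_fun_tau Y smooth_fun_der f)
  also have "(\<lambda>j. X p (der j f)) = (\<lambda>j. \<Sum>i\<in>UNIV. \<tau> i p (X p) * der i (der j f) p)"
    by (rule ext) (rule tau_sum_der[OF Xp])
  also have "(\<Sum>j\<in>UNIV. X p (\<lambda>q. \<tau> j q (Y q)) * der j f p
        + \<tau> j p (Y p) * (\<Sum>i\<in>UNIV. \<tau> i p (X p) * der i (der j f) p))
      = (\<Sum>j\<in>UNIV. X p (\<lambda>q. \<tau> j q (Y q)) * der j f p)
        + (\<Sum>j\<in>UNIV. \<Sum>i\<in>UNIV. \<tau> i p (X p) * \<tau> j p (Y p) * der i (der j f) p)"
    by (simp add: sum.distrib sum_distrib_left mult_ac)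
  also have "(\<Sum>j\<in>UNIV. \<Sum>i\<in>UNIV. \<tau> i p (X p) * \<tau> j p (Y p) * der i (der j f) p)
      = (\<Sum>i\<in>UNIV. \<Sum>j\<in>UNIV. \<tau> i p (X p) * \<tau> j p (Y p) * der i (der j f) p)"
    by (rule sum.swap)
  finally show ?thesis .
qed

text \<open>Torsion vanishes because second derivatives commute. Compatibility is the product rule,
  with no term from the coefficients since they are constants.\<close>

lemma flat_connection_levi_civita: "is_levi_civita A metric flat_connection"
  unfolding is_levi_civita_def
proof (intro conjI allI impI affine_flat_connection)
  fix X Y p and f :: "'a \<Rightarrow> real"
  assume *: "smooth_field A X \<and> smooth_field A Y"
  show "flat_connection X Y p f - flat_connection Y X p f = lie_bracket X Y p f"
  proof (cases "smooth_fun A f")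
    case True
    have "(\<Sum>i\<in>UNIV. \<Sum>j\<in>UNIV. \<tau> i p (Y p) * \<tau> j p (X p) * der i (der j f) p)
        = (\<Sum>i\<in>UNIV. \<Sum>j\<in>UNIV. \<tau> i p (X p) * \<tau> j p (Y p) * der i (der j f) p)"
      by (subst sum.swap) (simp add: der_commute[OF True] mult_ac)
    then show ?thesis
      using * by (simp add: lie_bracket_def flat_connection_def field_field_der True tvec_def)
  next
    \<comment> \<open>Torsion-freeness is demanded for every f; on non-smooth functions tangent
      vectors take the default value 0 and both sides vanish.\<close>
    case False
    then have "(\<lambda>q. Y q f) = (\<lambda>q. 0)" "(\<lambda>q. X q f) = (\<lambda>q. 0)"
      using * tangent_nonsmooth smooth_fieldD by blast+
    then show ?thesis
      using * False by (simp add: lie_bracket_def flat_connection_def tvec_nonsmooth tangent_const[OF smooth_fieldD])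
  qed
next
  fix X Y Z p
  assume *: "smooth_field A X \<and> smooth_field A Y \<and> smooth_field A Z"
  then have Xp: "X p \<in> tangent_space A p" by (simp add: smooth_fieldD)
  have sm: "smooth_fun A (\<lambda>q. \<tau> i q (Y q))" "smooth_fun A (\<lambda>q. \<tau> i q (Z q))" for i
    using * by (simp_all add: smooth_fun_tau)
  have "X p (\<lambda>q. metric q (Y q) (Z q)) = (\<Sum>i\<in>UNIV. \<Sum>j\<in>UNIV.
      C $ i $ j * (X p (\<lambda>q. \<tau> i q (Y q)) * \<tau> j p (Z p) + \<tau> i p (Y p) * X p (\<lambda>q. \<tau> j q (Z q))))"
    unfolding metric_def mult.assoc
    by (simp add: tangent_sum[OF Xp] tangent_cmult[OF Xp] tangent_mult[OF Xp] sm
        smooth_fun_sum smooth_fun_mult)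
  then show "X p (\<lambda>q. metric q (Y q) (Z q))
      = metric p (flat_connection X Y p) (Z p) + metric p (Y p) (flat_connection X Z p)"
    by (simp add: metric_def flat_connection_def distrib_left sum.distrib mult_ac)
qed

text \<open>\<open>levi_civita\<close> is a choice, and this is what pins it down on smooth fields.
  The form \<open>S\<close> is the difference of the two connections paired with a third field:
  vanishing torsion makes it symmetric in the first two slots, compatibility makes it skew in the
  last two.\<close>

lemma levi_civita_unique:
  assumes D: "is_levi_civita A metric D" and D': "is_levi_civita A metric D'"
    and X: "smooth_field A X" and Y: "smooth_field A Y"
  shows "D X Y p = D' X Y p"
proof -
  define t where "t X Y = (\<chi> i. \<tau> i p (D X Y p) - \<tau> i p (D' X Y p))" for X Y
  define S where "S X Y Z = t X Y \<bullet> (C *v (\<chi> i. \<tau> i p (Z p)))" for X Y Z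
  have tang: "D X Y p \<in> tangent_space A p" "D' X Y p \<in> tangent_space A p"
    if "smooth_field A X" "smooth_field A Y" for X Y
    using D D' that unfolding is_levi_civita_def affine_connection_def by (auto intro: smooth_fieldD)
  have S_metric: "S X Y Z = metric p (D X Y p) (Z p) - metric p (D' X Y p) (Z p)" for X Y Z
  proof -
    have "t X Y = (\<chi> i. \<tau> i p (D X Y p)) - (\<chi> i. \<tau> i p (D' X Y p))"
      by (simp add: t_def vec_eq_iff)
    then show ?thesis by (simp add: S_def metric_eq_inner inner_diff_left)
  qed
  have t_sym: "t X Y = t Y X" if XY: "smooth_field A X" "smooth_field A Y" for X Y
  proof -
    have "(\<lambda>f. 1 * D X Y p f + (- 1) * D Y X p f) = (\<lambda>f. 1 * D' X Y p f + (- 1) * D' Y X p f)"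
      using D D' XY unfolding is_levi_civita_def by simp
    then have "\<tau> i p (\<lambda>f. 1 * D X Y p f + (- 1) * D Y X p f)
        = \<tau> i p (\<lambda>f. 1 * D' X Y p f + (- 1) * D' Y X p f)" for i
      by (rule arg_cong)
    then have "\<tau> i p (D X Y p) - \<tau> i p (D Y X p) = \<tau> i p (D' X Y p) - \<tau> i p (D' Y X p)" for i
      using tau_lincomb[OF tang(1)[OF XY] tang(1)[OF XY(2,1)], of i 1 "- 1"]
        tau_lincomb[OF tang(2)[OF XY] tang(2)[OF XY(2,1)], of i 1 "- 1"] by simp
    then show ?thesis by (simp add: t_def vec_eq_iff algebra_simps)
  qed
  have S_anti: "S X Y Z = - S X Z Y"
    if "smooth_field A X" "smooth_field A Y" "smooth_field A Z" for X Y Z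
  proof -
    have "metric p (D X Y p) (Z p) + metric p (Y p) (D X Z p)
        = metric p (D' X Y p) (Z p) + metric p (Y p) (D' X Z p)"
    proof -
      have "X p (\<lambda>q. metric q (Y q) (Z q)) = metric p (D X Y p) (Z p) + metric p (Y p) (D X Z p)"
        "X p (\<lambda>q. metric q (Y q) (Z q)) = metric p (D' X Y p) (Z p) + metric p (Y p) (D' X Z p)"
        using D D' that unfolding is_levi_civita_def by simp_all
      then show ?thesis by simp
    qed
    then show ?thesis
      by (simp add: S_metric metric_sym[of p "Y p"])
  qed
  have S_sym: "S X Y Z = S Y X Z" if "smooth_field A X" "smooth_field A Y" for X Y Z
    using t_sym[OF that] by (simp add: S_def)
  \<comment> \<open>a trilinear form that is symmetric in two slots and skew in two others vanishes\<close>
  have S0: "S X Y Z = 0" if Z: "smooth_field A Z" for Z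
  proof -
    have "S X Y Z = - S X Z Y" "S X Z Y = S Z X Y" "S Z X Y = - S Z Y X" "S Z Y X = S Y Z X"
      "S Y Z X = - S Y X Z" "S Y X Z = S X Y Z"
      by (rule S_anti S_sym X Y Z)+
    then show ?thesis by linarith
  qed
  \<comment> \<open>The third field is the constant-coefficient field whose coefficients are the
    difference vector itself, so positive definiteness applies.\<close>
  have "t X Y \<bullet> (C *v t X Y) = 0"
    using S0[OF smooth_field_angle[of "t X Y"]] by (simp add: S_def)
  then have "t X Y = 0" using pos_def[of "t X Y"] by force
  then show ?thesis
    using tang[OF X Y] by (intro tangent_eqI) (auto simp: t_def vec_eq_iff)
qed

lemma levi_civita_eq:
  "smooth_field A X \<Longrightarrow> smooth_field A Y \<Longrightarrow> levi_civita A metric X Y p = flat_connection X Y p"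
  using levi_civita_unique flat_connection_levi_civita someI[of "is_levi_civita A metric"]
  unfolding levi_civita_def by metis

subsection \<open>The Laplacian\<close>

lemma invertible_coeff: "invertible C"
  by (rule invertible_pos_def[OF pos_def])

lemma coeff_inverse [simp]: "C *v (matrix_inv C *v x) = x"
  by (simp add: matrix_vector_mul_assoc matrix_inv_mult[OF invertible_coeff])

lemma grad_eq:
  assumes f: "smooth_fun A f"
  shows "grad A metric f p = tvec (matrix_inv C *v (\<chi> j. der j f p)) p"
  unfolding grad_def
proof (rule the_equality)
  let ?a = "matrix_inv C *v (\<chi> j. der j f p)"
  have grad: "metric p (tvec ?a p) (tvec b p) = tvec b p f" for b
    by (simp add: metric_tvec symmetric_matrix_inner[OF sym])
      (simp add: tvec_def inner_vec_def mult.commute)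
  then show "tvec ?a p \<in> tangent_space A p \<and> (\<forall>u\<in>tangent_space A p. metric p (tvec ?a p) u = u f)"
    by (auto simp: tvec_in_tangent_space tangent_space_eq)
  fix x assume x: "x \<in> tangent_space A p \<and> (\<forall>u\<in>tangent_space A p. metric p x u = u f)"
  then obtain b where b: "x = tvec b p" by (auto simp: tangent_space_eq)
  have "(b - ?a) \<bullet> (C *v c) = 0" for c
  proof -
    have "metric p (tvec b p) (tvec c p) = tvec c p f"
      using x tvec_in_tangent_space by (auto simp: b)
    then show ?thesis using grad[of c] by (simp add: inner_diff_left metric_tvec)
  qed
  \<comment> \<open>The test vector is c = b - \<open>?a\<close>.\<close>
  then have "b = ?a" using pos_def[of "b - ?a"] by fastforce
  then show "x = tvec ?a p" using b by simp
qed

text \<open>\<open>divergence\<close> uses an unspecified frame that need be orthonormal only at p.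
  Constant-coefficient fields show that such a frame exists; for whichever one is chosen, the sum is
  the trace of the Jacobian \<open>J\<close> of the components.\<close>

lemma divergence_tvec:
  assumes a: "\<And>i. smooth_fun A (\<lambda>p. a p $ i)"
  shows "divergence A metric (\<lambda>p. tvec (a p) p) p = (\<Sum>j\<in>UNIV. der j (\<lambda>q. a q $ j) p)"
proof -
  let ?P = "\<lambda>E :: 'm \<Rightarrow> 'a vfield. (\<forall>i. smooth_field A (E i)) \<and>
    (\<forall>i j. metric p (E i p) (E j p) = (if i = j then 1 else 0))"
  define F where "F = (SOME E. ?P E)"
  obtain e :: "'m \<Rightarrow> real^'m" where "\<And>i j. e i \<bullet> (C *v e j) = (if i = j then 1 else 0)"
    using pos_def_orthonormal_basis[OF sym] pos_def by blast
  then have "?P (\<lambda>i p. tvec (e i) p)"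
    by (simp add: metric_tvec smooth_field_angle)
  then have "\<exists>E. ?P E" by (rule exI[of ?P "\<lambda>i. tvec (e i)"])
  then have F: "?P F" unfolding F_def by (rule someI_ex)
  define c where "c i = (\<chi> k. \<tau> k p (F i p))" for i
  have Fi: "F i p = tvec (c i) p" for i
    unfolding c_def using F by (intro tangent_eq_tvec smooth_fieldD) simp
  have orth: "c i \<bullet> (C *v c j) = (if i = j then 1 else 0)" for i j
    using F by (simp add: Fi metric_tvec)
  define J :: "real^'m^'m" where "J = (\<chi> j k. der k (\<lambda>q. a q $ j) p)"
  have "metric p (levi_civita A metric (F i) (\<lambda>p. tvec (a p) p) p) (F i p) = (J *v c i) \<bullet> (C *v c i)" for i
  proof -
    have "flat_connection (F i) (\<lambda>p. tvec (a p) p) p = tvec (J *v c i) p"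
      by (simp add: flat_connection_def Fi)
        (simp add: tvec_def J_def matrix_vector_mult_def mult.commute)
    then show ?thesis
      using F by (simp add: levi_civita_eq smooth_field_tvec a) (simp add: Fi metric_tvec)
  qed
  then have "divergence A metric (\<lambda>p. tvec (a p) p) p = (\<Sum>i\<in>UNIV. (J *v c i) \<bullet> (C *v c i))"
    unfolding divergence_def Let_def F_def[symmetric] by simp
  also have "\<dots> = trace J" by (rule trace_orthonormal_basis[OF sym orth])
  finally show ?thesis by (simp add: trace_def J_def)
qed

lemma laplacian_real_eq:
  assumes f: "smooth_fun A f"
  shows "laplacian_real A metric f p
    = - (\<Sum>i\<in>UNIV. \<Sum>j\<in>UNIV. matrix_inv C $ i $ j * der i (der j f) p)"
proof -
  let ?a = "\<lambda>p. matrix_inv C *v (\<chi> j. der j f p)"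
  have comp: "?a q $ i = (\<Sum>j\<in>UNIV. matrix_inv C $ i $ j * der j f q)" for q i
    by (simp add: matrix_vector_mult_def)
  have "smooth_fun A (\<lambda>q. ?a q $ i)" for i
    unfolding comp by (intro smooth_fun_sum smooth_fun_cmult smooth_fun_der f)
  then have "divergence A metric (\<lambda>p. tvec (?a p) p) p = (\<Sum>j\<in>UNIV. der j (\<lambda>q. ?a q $ j) p)"
    by (rule divergence_tvec)
  moreover have "grad A metric f = (\<lambda>p. tvec (?a p) p)"
    by (simp add: fun_eq_iff grad_eq[OF f])
  ultimately show ?thesis
    unfolding laplacian_real_def comp
    by (simp add: der_sum der_cmult smooth_fun_cmult smooth_fun_der f)
qed

lemma smooth_fun_laplacian_real:
  assumes "smooth_fun A f"
  shows "smooth_fun A (laplacian_real A metric f)"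
  unfolding laplacian_real_eq[OF assms, abs_def] sum_negf[symmetric] mult_minus_left[symmetric]
  by (intro smooth_fun_sum smooth_fun_cmult smooth_fun_der assms)

end

section \<open>The flow in angle coordinates\<close>

text \<open>Brings a derivative at 0 into the shape of the difference quotient in
  \<open>koopman_generator\<close>.\<close>

lemma has_vector_derivative_quotient:
  assumes "(f has_vector_derivative D) (at 0)"
  shows "((\<lambda>t. (f t - f 0) /\<^sub>R t) \<longlongrightarrow> D) (at 0)"
proof -
  have "((\<lambda>t. norm (f t - f 0 - t *\<^sub>R D) / norm t) \<longlongrightarrow> 0) (at 0)"
    using assms by (simp add: has_vector_derivative_def has_derivative_at)
  moreover have "\<forall>\<^sub>F t in at 0. norm (f t - f 0 - t *\<^sub>R D) / norm t = norm ((f t - f 0) /\<^sub>R t - D)"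
    unfolding eventually_at_filter
  proof (intro always_eventually allI impI)
    fix t :: real assume "t \<noteq> 0"
    then have "(f t - f 0) /\<^sub>R t - D = (f t - f 0 - t *\<^sub>R D) /\<^sub>R t"
      by (simp add: scaleR_diff_right)
    then show "norm (f t - f 0 - t *\<^sub>R D) / norm t = norm ((f t - f 0) /\<^sub>R t - D)"
      by (simp add: divide_inverse mult.commute)
  qed
  ultimately have "((\<lambda>t. norm ((f t - f 0) /\<^sub>R t - D)) \<longlongrightarrow> 0) (at 0)"
    by (rule Lim_transform_eventually)
  then show ?thesis
    by (simp add: tendsto_norm_zero_iff Lim_null[symmetric])
qed

lemma smooth_mapD:
  assumes "smooth_map M A N A' h" "(U, \<phi>) \<in> A" "(V, \<psi>) \<in> A'"
  shows "smooth_on (\<phi> ` (U \<inter> h -` V)) (\<psi> \<circ> h \<circ> inv_into U \<phi>)"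
  using assms unfolding smooth_map_def by fast

section \<open>From the generator on L^2 to derivatives along orbits\<close>

context smooth_manifold
begin

text \<open>The set where f and g differ is open. Positivity of the density makes the chart image of
  a \<mu>-null part of it Lebesgue-null, which a nonempty open set cannot be.\<close>

lemma AE_eq_imp_eq:
  fixes f g :: "'a \<Rightarrow> complex"
  assumes dens: "smooth_positive_density A \<mu>" and sets: "sets \<mu> = sets borel"
    and f: "continuous_on UNIV f" and g: "continuous_on UNIV g" and ae: "AE p in \<mu>. f p = g p"
  shows "f p = g p"
proof (rule ccontr)
  assume neq: "f p \<noteq> g p"
  obtain U \<phi> where U: "(U, \<phi>) \<in> A" "p \<in> U" using chart_exists by blast
  define V where "V = {q. f q \<noteq> g q} \<inter> U"
  have V: "open V" "V \<subseteq> U" "p \<in> V"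
    using U neq open_chart_domain[OF U(1)] open_Collect_neq[OF f g] by (auto simp: V_def)
  have \<phi>V: "open (\<phi> ` V)" by (rule open_chart_image_subset[OF U(1) V(1,2)])
  obtain \<rho> where \<rho>: "smooth_on (\<phi> ` U) \<rho>" "\<And>x. x \<in> \<phi> ` U \<Longrightarrow> 0 < \<rho> x"
    "\<And>E. E \<in> sets borel \<Longrightarrow> E \<subseteq> U \<Longrightarrow>
      emeasure \<mu> E = (\<integral>\<^sup>+x. ennreal (\<rho> x) * indicator (\<phi> ` E) x \<partial>lborel)"
    using bspec[OF dens[unfolded smooth_positive_density_def] U(1)] by auto
  \<comment> \<open>The density is controlled on the chart image only, so measurability is obtained
    after cutting off with the indicator.\<close>
  have "(\<lambda>x. indicator (\<phi> ` V) x *\<^sub>R \<rho> x) \<in> borel_measurable lborel"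
    using borel_measurable_continuous_on_indicator[OF _ continuous_on_subset[OF
        smooth_on_imp_continuous_on[OF \<rho>(1)] image_mono[OF V(2)]]] \<phi>V by simp
  then have "(\<lambda>x. ennreal (indicator (\<phi> ` V) x *\<^sub>R \<rho> x)) \<in> borel_measurable lborel"
    by (rule measurable_compose) simp
  moreover have "(\<lambda>x. ennreal (indicator (\<phi> ` V) x *\<^sub>R \<rho> x))
      = (\<lambda>x. ennreal (\<rho> x) * indicator (\<phi> ` V) x)"
    by (auto simp: fun_eq_iff indicator_def)
  ultimately have meas: "(\<lambda>x. ennreal (\<rho> x) * indicator (\<phi> ` V) x) \<in> borel_measurable lborel"
    by simp
  have "AE q in \<mu>. q \<notin> V"
    using ae by eventually_elim (simp add: V_def)
  then have "emeasure \<mu> V = 0"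
    using emeasure_eq_0_AE[of "\<lambda>q. q \<in> V" \<mu>] sets_eq_imp_space_eq[OF sets] by simp
  then have "AE x in lborel. ennreal (\<rho> x) * indicator (\<phi> ` V) x = 0"
    using \<rho>(3)[of V] V by (simp add: nn_integral_0_iff_AE[OF meas])
  then have "AE x in lborel. x \<notin> \<phi> ` V"
  proof eventually_elim
    case (elim x)
    then show ?case
      using \<rho>(2)[of x] V(2) by (auto simp: indicator_def split: if_splits)
  qed
  then have "emeasure lborel (\<phi> ` V) = 0"
    using emeasure_eq_0_AE[of "\<lambda>x. x \<in> \<phi> ` V" lborel] by simp
  then have "\<phi> ` V \<in> null_sets lborel"
    using \<phi>V by (intro null_setsI) auto
  then have "negligible (\<phi> ` V)"
    by (simp add: negligible_iff_null_sets null_sets_completionI)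
  then show False
    using open_not_negligible[OF \<phi>V] V(3) by auto
qed

lemma continuous_imp_integrable:
  fixes f :: "'a \<Rightarrow> 'b::{second_countable_topology, banach}"
  assumes "compact (UNIV :: 'a set)" "prob_space \<mu>" "sets \<mu> = sets borel" "continuous_on UNIV f"
  shows "integrable \<mu> f"
proof -
  interpret prob_space \<mu> by fact
  have "bounded (range f)"
    using compact_continuous_image[OF assms(4,1)] by (rule compact_imp_bounded)
  then obtain B where "\<And>p. norm (f p) \<le> B" by (auto simp: bounded_iff)
  moreover have "f \<in> borel_measurable \<mu>"
    using borel_measurable_continuous_onI[OF assms(4)] assms(3)
    by (simp cong: measurable_cong_sets)
  ultimately show ?thesis
    by (intro integrable_const_bound[of _ B]) auto
qed

lemma continuous_on_flow:
  assumes "smooth_flow A \<Phi>"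
  shows "continuous_on UNIV (\<lambda>(t, p). \<Phi> t p)" "continuous_on UNIV (\<Phi> t)"
proof -
  show c: "continuous_on UNIV (\<lambda>(t, p). \<Phi> t p)"
    using assms by (simp add: smooth_flow_def smooth_map_def)
  have "continuous_on UNIV (\<lambda>p. (\<lambda>(t, p). \<Phi> t p) (t, p))"
    by (rule continuous_on_compose2[OF c]) (auto intro!: continuous_intros)
  then show "continuous_on UNIV (\<Phi> t)" by simp
qed

text \<open>Smoothness of the flow is stated from chart to chart, so \<open>N\<close> collects the
  times and points whose image stays in the same chart. It is open and contains time 0 over the
  whole chart, which is enough for derivatives at time 0.\<close>

lemma flow_chart:
  fixes f :: "'a \<Rightarrow> 'b::real_normed_vector"
  assumes flow: "smooth_flow A \<Phi>" and f: "smooth_fun A f" and U: "(U, \<phi>) \<in> A"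
  obtains N where "open N" "\<And>q. q \<in> U \<Longrightarrow> (0, \<phi> q) \<in> N"
    "smooth_on N (\<lambda>(t, y). f (\<Phi> t (inv_into U \<phi> y)))"
proof
  define L where "L = (UNIV :: real set) \<times> U"
  define \<kappa> where "\<kappa> = (\<lambda>(t :: real, p). (t, \<phi> p))"
  define \<Phi>' where "\<Phi>' = (\<lambda>(t, p). \<Phi> t p)"
  define N where "N = {ty \<in> UNIV \<times> \<phi> ` U. \<Phi> (fst ty) (inv_into U \<phi> (snd ty)) \<in> U}"
  have inj: "inj_on \<kappa> L"
    unfolding L_def \<kappa>_def using chart_inverse[OF U] by (auto intro!: inj_onI) metis
  have inv: "inv_into L \<kappa> (t, \<phi> q) = (t, q)" if "q \<in> U" for t q
    using inv_into_f_f[OF inj, of "(t, q)"] that by (simp add: L_def \<kappa>_def)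
  have N_eq: "\<kappa> ` (L \<inter> \<Phi>' -` U) = N"
    using chart_inverse[OF U] by (force simp: N_def L_def \<kappa>_def \<Phi>'_def image_iff)
  have "(L, \<kappa>) \<in> line_product_atlas A"
    unfolding L_def \<kappa>_def line_product_atlas_def using U by force
  then have sm: "smooth_on N (\<phi> \<circ> \<Phi>' \<circ> inv_into L \<kappa>)"
    using flow U smooth_mapD[of UNIV "line_product_atlas A" UNIV A \<Phi>' L \<kappa> U \<phi>]
    unfolding N_eq smooth_flow_def \<Phi>'_def[symmetric] by simp
  have cont: "continuous_on (UNIV \<times> \<phi> ` U) (\<lambda>ty. \<Phi> (fst ty) (inv_into U \<phi> (snd ty)))"
  proof -
    have c2: "continuous_on ((UNIV :: real set) \<times> \<phi> ` U) (\<lambda>ty. inv_into U \<phi> (snd ty))"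
      by (rule continuous_on_compose2[OF continuous_on_chart_inverse[OF U] continuous_on_snd[OF continuous_on_id]])
        auto
    have "continuous_on (UNIV \<times> \<phi> ` U) (\<lambda>ty. (\<lambda>(t, p). \<Phi> t p) (fst ty, inv_into U \<phi> (snd ty)))"
      by (rule continuous_on_compose2[OF continuous_on_flow(1)[OF flow]])
        (use c2 in \<open>auto intro!: continuous_on_Pair continuous_on_fst continuous_on_id\<close>)
    then show ?thesis by simp
  qed
  have "open ((UNIV :: real set) \<times> \<phi> ` U)"
    using open_chart_image[OF U] by (intro open_Times) auto
  from continuous_open_preimage[OF cont this open_chart_domain[OF U]]
  show oN: "open N"
    by (auto simp: N_def vimage_def Int_def)
  show "(0, \<phi> q) \<in> N" if "q \<in> U" for q
    using that flow by (simp add: N_def chart_inverse[OF U] smooth_flow_def)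
  have "smooth_on N (\<lambda>ty. f (inv_into U \<phi> ((\<phi> \<circ> \<Phi>' \<circ> inv_into L \<kappa>) ty)))"
  proof (rule smooth_on_compose[OF oN open_chart_image[OF U] sm smooth_funD[OF f U]])
    show "(\<phi> \<circ> \<Phi>' \<circ> inv_into L \<kappa>) ` N \<subseteq> \<phi> ` U"
      by (auto simp: N_def inv \<Phi>'_def chart_inverse[OF U])
  qed
  then show "smooth_on N (\<lambda>(t, y). f (\<Phi> t (inv_into U \<phi> y)))"
    by (rule smooth_on_cong[OF _ oN]) (auto simp: N_def inv \<Phi>'_def chart_inverse[OF U])
qed

text \<open>In a chart the time derivative at 0 is the derivative of a jointly smooth function along
  (1, 0). This yields both its existence and its continuity in p.\<close>

lemma
  fixes f :: "'a \<Rightarrow> 'b::real_normed_vector"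
  assumes flow: "smooth_flow A \<Phi>" and f: "smooth_fun A f"
  shows has_vector_derivative_flow: "((\<lambda>t. f (\<Phi> t p)) has_vector_derivative flow_field \<Phi> f p) (at 0)"
    and continuous_on_flow_field: "continuous_on UNIV (flow_field \<Phi> f)"
proof -
  have *: "((\<lambda>t. f (\<Phi> t p)) has_vector_derivative flow_field \<Phi> f p) (at 0) \<and> isCont (flow_field \<Phi> f) p"
    for p
  proof -
    obtain U \<phi> where U: "(U, \<phi>) \<in> A" "p \<in> U" using chart_exists by blast
    define h where "h = (\<lambda>(t, y). f (\<Phi> t (inv_into U \<phi> y)))"
    obtain N where N: "open N" "\<And>q. q \<in> U \<Longrightarrow> (0, \<phi> q) \<in> N" "smooth_on N h"
      using flow_chart[OF flow f U(1)] unfolding h_def by metis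
    have D: "((\<lambda>t. f (\<Phi> t q)) has_vector_derivative frechet_derivative h (at (0, \<phi> q)) (1, 0)) (at 0)"
      if "q \<in> U" for q
    proof -
      have "h differentiable (at (0, \<phi> q))"
        using N that by (blast intro: smooth_on_imp_differentiable)
      then have "(h has_derivative frechet_derivative h (at (0, \<phi> q))) (at (0, \<phi> q))"
        using frechet_derivative_works by blast
      moreover have "((\<lambda>t. (t, \<phi> q)) has_vector_derivative (1, 0)) (at 0)"
        by (intro has_vector_derivative_Pair) (auto intro: derivative_eq_intros)
      ultimately have "(h \<circ> (\<lambda>t. (t, \<phi> q)) has_vector_derivative frechet_derivative h (at (0, \<phi> q)) (1, 0)) (at 0)"
        by (intro vector_derivative_diff_chain_within) (auto intro: has_derivative_at_withinI)
      then show ?thesis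
        using that by (simp add: h_def o_def chart_inverse[OF U(1)])
    qed
    then have F: "flow_field \<Phi> f q = frechet_derivative h (at (0, \<phi> q)) (1, 0)" if "q \<in> U" for q
      using that unfolding flow_field_def by (blast intro: vector_derivative_at)
    have "continuous_on N (\<lambda>ty. frechet_derivative h (at ty) (1, 0))"
      by (intro smooth_on_imp_continuous_on smooth_on_frechet_derivative N)
    then have "continuous_on U (\<lambda>q. frechet_derivative h (at (0, \<phi> q)) (1, 0))"
      by (rule continuous_on_compose2) (use N(2) continuous_on_chart[OF U(1)] in \<open>auto intro!: continuous_intros\<close>)
    then have "continuous_on U (flow_field \<Phi> f)"
      using F by (simp cong: continuous_on_cong)
    then show ?thesis
      using D[OF U(2)] F[OF U(2)] U(2) open_chart_domain[OF U(1)]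
      by (simp add: continuous_on_eq_continuous_at)
  qed
  show "((\<lambda>t. f (\<Phi> t p)) has_vector_derivative flow_field \<Phi> f p) (at 0)"
    using * by blast
  show "continuous_on UNIV (flow_field \<Phi> f)"
    using * by (simp add: continuous_at_imp_continuous_on)
qed

lemma koopman_eigenfunction_flow_field:
  assumes comp: "compact (UNIV :: 'a set)" and flow: "smooth_flow A \<Phi>"
    and prob: "prob_space \<mu>" and sets: "sets \<mu> = sets borel"
    and dens: "smooth_positive_density A \<mu>"
    and f: "smooth_fun A f" and eig: "koopman_eigenfunction \<mu> \<Phi> c f"
  shows "flow_field \<Phi> f p = c * f p"
proof -
  have cf: "continuous_on UNIV f" by (rule smooth_fun_imp_continuous[OF f])
  have cft: "continuous_on UNIV (\<lambda>p. f (\<Phi> t p))" for t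
    by (rule continuous_on_compose2[OF cf continuous_on_flow(2)[OF flow]]) auto
  \<comment> \<open>Fatou's lemma concerns sequences, so t tends to 0 along this one, whose terms
    are never 0.\<close>
  define w where "w n = 1 / real (Suc n)" for n
  have w0: "w \<longlonglongrightarrow> 0" unfolding w_def by (rule LIMSEQ_Suc[OF lim_1_over_n])
  then have w: "filterlim w (at 0) sequentially"
    by (simp add: filterlim_at w_def)
  define u where "u n p = (norm ((f (\<Phi> (w n) p) - f p) /\<^sub>R w n - c * f p))\<^sup>2" for n p
  have cu: "continuous_on UNIV (u n)" for n
    unfolding u_def by (intro continuous_intros cf cft)
  have int: "integrable \<mu> (u n)" for n
    by (rule continuous_imp_integrable[OF comp prob sets cu])
  have "((\<lambda>t. \<integral>p. (norm ((f (\<Phi> t p) - f p) /\<^sub>R t - c * f p))\<^sup>2 \<partial>\<mu>) \<longlongrightarrow> 0) (at 0)"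
    using eig by (simp add: koopman_eigenfunction_def koopman_generator_def)
  from filterlim_compose[OF this w] have lim0: "(\<lambda>n. \<integral>p. u n p \<partial>\<mu>) \<longlonglongrightarrow> 0"
    by (simp add: u_def)
  define L where "L p = flow_field \<Phi> f p - c * f p" for p
  have pw: "(\<lambda>n. u n p) \<longlonglongrightarrow> (norm (L p))\<^sup>2" for p
  proof -
    have "((\<lambda>t. (f (\<Phi> t p) - f p) /\<^sub>R t) \<longlongrightarrow> flow_field \<Phi> f p) (at 0)"
      using has_vector_derivative_flow[OF flow f, of p] flow
      by (auto simp: smooth_flow_def dest: has_vector_derivative_quotient)
    from filterlim_compose[OF this w] show ?thesis
      unfolding u_def L_def by (intro tendsto_intros)
  qed
  \<comment> \<open>The integrands converge pointwise to the squared defect of the eigenvalue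
    equation while their integrals tend to 0; hence the defect is 0 almost everywhere, and
    everywhere by continuity.\<close>
  have "(\<integral>\<^sup>+p. ennreal ((norm (L p))\<^sup>2) \<partial>\<mu>) = (\<integral>\<^sup>+p. liminf (\<lambda>n. ennreal (u n p)) \<partial>\<mu>)"
    by (intro nn_integral_cong lim_imp_Liminf[symmetric] tendsto_ennrealI pw) simp
  also have "\<dots> \<le> liminf (\<lambda>n. \<integral>\<^sup>+p. ennreal (u n p) \<partial>\<mu>)"
    by (rule nn_integral_liminf) (use int in measurable)
  also have "(\<lambda>n. \<integral>\<^sup>+p. ennreal (u n p) \<partial>\<mu>) = (\<lambda>n. ennreal (\<integral>p. u n p \<partial>\<mu>))"
    by (intro ext nn_integral_eq_integral int) (simp add: u_def)
  also have "liminf (\<lambda>n. ennreal (\<integral>p. u n p \<partial>\<mu>)) = ennreal 0"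
    by (intro lim_imp_Liminf tendsto_ennrealI lim0) simp
  finally have zero: "(\<integral>\<^sup>+p. ennreal ((norm (L p))\<^sup>2) \<partial>\<mu>) = 0" by simp
  have cL: "continuous_on UNIV L"
    unfolding L_def by (intro continuous_intros continuous_on_flow_field[OF flow f] cf)
  then have "continuous_on UNIV (\<lambda>p. (norm (L p))\<^sup>2)" by (intro continuous_intros)
  from continuous_imp_integrable[OF comp prob sets this]
  have "(\<lambda>p. ennreal ((norm (L p))\<^sup>2)) \<in> borel_measurable \<mu>" by measurable
  from nn_integral_0_iff_AE[OF this] zero have "AE p in \<mu>. L p = 0" by simp
  from AE_eq_imp_eq[OF dens sets cL _ this] have "L p = 0" by simp
  then show ?thesis by (simp add: L_def)
qed

text \<open>Removing the expected phase leaves a curve with zero derivative. The hypothesis concerns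
  time 0, and the group law carries it to time t.\<close>

lemma eigenfunction_along_flow:
  fixes f :: "'a \<Rightarrow> complex"
  assumes flow: "smooth_flow A \<Phi>" and f: "smooth_fun A f"
    and eig: "\<And>p. flow_field \<Phi> f p = \<i> * of_real a * f p"
  shows "f (\<Phi> t p) = cis (a * t) * f p"
proof -
  have D: "((\<lambda>t. f (\<Phi> t p)) has_vector_derivative \<i> * of_real a * f (\<Phi> t p)) (at t)" for t
  proof -
    \<comment> \<open>Time 0 is written as \<open>t - t\<close> to match the chain rule for the
      shift by t.\<close>
    have "((\<lambda>s. f (\<Phi> s (\<Phi> t p))) has_vector_derivative \<i> * of_real a * f (\<Phi> t p)) (at (t - t))"
      using has_vector_derivative_flow[OF flow f, of "\<Phi> t p"] by (simp add: eig)
    moreover have "((\<lambda>r. r - t) has_vector_derivative 1) (at t)"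
      by (auto intro!: derivative_eq_intros)
    ultimately have "((\<lambda>s. f (\<Phi> s (\<Phi> t p))) \<circ> (\<lambda>r. r - t) has_vector_derivative
        1 *\<^sub>R (\<i> * of_real a * f (\<Phi> t p))) (at t)"
      by (intro vector_diff_chain_at)
    moreover have "\<Phi> (r - t) (\<Phi> t p) = \<Phi> r p" for r
      using flow by (metis diff_add_cancel smooth_flow_def)
    ultimately show ?thesis by (simp add: o_def)
  qed
  have "((\<lambda>t. cis (- (a * t)) * f (\<Phi> t p)) has_vector_derivative 0) (at t)" for t
  proof -
    have "((\<lambda>t. cis (- (a * t))) has_vector_derivative - (\<i> * of_real a) * cis (- (a * t))) (at t)"
      unfolding has_vector_derivative_def
      by (auto intro!: derivative_eq_intros simp: scaleR_conv_of_real mult_ac)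
    from has_vector_derivative_mult[OF this D[of t]] show ?thesis
      by (simp add: algebra_simps)
  qed
  then obtain k where "\<And>t. t \<in> UNIV \<Longrightarrow> cis (- (a * t)) * f (\<Phi> t p) = k"
    by (rule has_vector_derivative_zero_constant[OF convex_UNIV]) auto
  from this[of t] this[of 0] have "cis (- (a * t)) * f (\<Phi> t p) = cis (- (a * 0)) * f (\<Phi> 0 p)"
    by simp
  then have "cis (a * t) * (cis (- (a * t)) * f (\<Phi> t p)) = cis (a * t) * f p"
    using flow by (simp add: smooth_flow_def)
  then show ?thesis by (simp add: mult.assoc[symmetric] cis_mult)
qed

lemma flow_field_complex:
  assumes "smooth_flow A \<Phi>" "smooth_fun A f"
  shows "flow_field \<Phi> f p = Complex (flow_field \<Phi> (\<lambda>p. Re (f p)) p) (flow_field \<Phi> (\<lambda>p. Im (f p)) p)"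
proof -
  note D = has_vector_derivative_flow[OF assms, of p]
  have "flow_field \<Phi> (\<lambda>p. Re (f p)) p = Re (flow_field \<Phi> f p)"
    unfolding flow_field_def[of _ "\<lambda>p. Re (f p)"]
    by (rule vector_derivative_at) (rule bounded_linear.has_vector_derivative[OF bounded_linear_Re D])
  moreover have "flow_field \<Phi> (\<lambda>p. Im (f p)) p = Im (flow_field \<Phi> f p)"
    unfolding flow_field_def[of _ "\<lambda>p. Im (f p)"]
    by (rule vector_derivative_at) (rule bounded_linear.has_vector_derivative[OF bounded_linear_Im D])
  ultimately show ?thesis by simp
qed

end

context torus_coordinates
begin

lemma flow_E:
  assumes "\<And>i t p. \<zeta> i (\<Phi> t p) = cis (\<Omega> $ i * t) * \<zeta> i p"
  shows "\<Phi> t (E x) = E (x + t *\<^sub>R \<Omega>)"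
  by (rule E_eqI[symmetric]) (simp add: assms cis_mult algebra_simps)

lemma flow_field_eq_tvec:
  assumes flow: "\<And>t x. \<Phi> t (E x) = E (x + t *\<^sub>R \<Omega>)" and f: "smooth_fun A f"
  shows "flow_field \<Phi> f p = tvec \<Omega> p f"
proof -
  obtain x where "p = E x" using E_surj by blast
  then show ?thesis
    using f by (simp add: tvec_E flow_field_def flow velocity_def)
qed

end

section \<open>Koopman eigenfunctions\<close>

lemma has_derivative_cis_inner:
  "((\<lambda>x. cis (l \<bullet> x)) has_derivative (\<lambda>w. (l \<bullet> w) *\<^sub>R (\<i> * cis (l \<bullet> x)))) (at x)"
  by (auto intro!: derivative_eq_intros simp: scaleR_conv_of_real)

lemma smooth_on_cis_inner:
  fixes l :: "'e::euclidean_space"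
  shows "smooth_on UNIV (\<lambda>x. cis (l \<bullet> x))"
proof -
  have "Ck_on n UNIV (\<lambda>x. cis (l \<bullet> x))" for n
  proof (induction n)
    case 0
    then show ?case by (auto intro!: continuous_intros)
  next
    case (Suc n)
    have "bounded_linear (\<lambda>z. (l \<bullet> w) *\<^sub>R (\<i> * z))" for w
      by (intro bounded_linear_compose[OF bounded_linear_scaleR_right] bounded_linear_mult_right)
    from Ck_on_bounded_linear[OF open_UNIV Suc this] show ?case
      using has_derivative_cis_inner[of l]
      by (auto simp: differentiable_def frechet_derivative_at[OF has_derivative_cis_inner, symmetric])
  qed
  then show ?thesis by (simp add: smooth_on_def)
qed

text \<open>The flow multiplies f by a phase, so the error of the difference quotient is f times a
  scalar independent of p. As f has modulus 1 and \<mu> has mass 1, the integral is the squared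
  modulus of that scalar.\<close>

lemma koopman_eigenfunctionI:
  fixes f :: "'a::topological_space \<Rightarrow> complex"
  assumes prob: "prob_space \<mu>" and sets: "sets \<mu> = sets borel"
    and f: "continuous_on UNIV f" and norm: "\<And>p. norm (f p) = 1"
    and flow: "\<And>t p. f (\<Phi> t p) = cis (a * t) * f p"
  shows "koopman_eigenfunction \<mu> \<Phi> (\<i> * of_real a) f"
proof -
  interpret prob_space \<mu> by fact
  have f_meas: "f \<in> borel_measurable \<mu>"
    using borel_measurable_continuous_onI[OF f] sets by (simp cong: measurable_cong_sets)
  have quot: "(f (\<Phi> t p) - f p) /\<^sub>R t - \<i> * of_real a * f p
      = ((cis (a * t) - 1) /\<^sub>R t - \<i> * of_real a) * f p" for t p
    by (simp add: flow algebra_simps)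
  have "((\<lambda>t. cis (a * t)) has_vector_derivative \<i> * of_real a) (at 0)"
    unfolding has_vector_derivative_def
    by (auto intro!: derivative_eq_intros simp: scaleR_conv_of_real mult_ac)
  from has_vector_derivative_quotient[OF this]
  have "((\<lambda>t. (norm ((cis (a * t) - 1) /\<^sub>R t - \<i> * of_real a))\<^sup>2)
      \<longlongrightarrow> (norm (\<i> * of_real a - \<i> * of_real a))\<^sup>2) (at 0)"
    by (intro tendsto_intros) simp
  then have "((\<lambda>t. \<integral>p. (norm ((f (\<Phi> t p) - f p) /\<^sub>R t - \<i> * of_real a * f p))\<^sup>2 \<partial>\<mu>) \<longlongrightarrow> 0) (at 0)"
    by (simp add: quot norm_mult norm prob_space)
  moreover have "\<not> (AE p in \<mu>. f p = 0)"
  proof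
    assume "AE p in \<mu>. f p = 0"
    then have "AE p in \<mu>. False"
      by eventually_elim (metis norm norm_zero zero_neq_one)
    then show False by simp
  qed
  ultimately show ?thesis
    using f_meas by (simp add: koopman_eigenfunction_def koopman_generator_def square_integrable_def norm_mult norm)
qed

context torus_coordinates
begin

lemma monomial_E: "monomial \<zeta> k (E x) = cis ((\<chi> i. of_int (k $ i)) \<bullet> x)"
proof -
  have "(\<Prod>i\<in>I. cis (g i)) = cis (\<Sum>i\<in>I. g i)" for I and g :: "'m \<Rightarrow> real"
    by (induction I rule: infinite_finite_induct) (auto simp: cis_mult)
  then show ?thesis
    by (simp add: monomial_def cis_power_int inner_vec_def)
qed

lemma smooth_fun_monomial: "smooth_fun A (monomial \<zeta> k)"
  by (simp add: smooth_fun_iff monomial_E smooth_on_cis_inner)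

lemma norm_monomial: "norm (monomial \<zeta> k p) = 1"
  using E_surj[of p] by (auto simp: monomial_E)

lemma cnj_monomial: "cnj (monomial \<zeta> k p) = monomial \<zeta> (- k) p"
proof -
  have "(\<chi> i. - (of_int (k $ i) :: real)) \<bullet> x = - ((\<chi> i. of_int (k $ i)) \<bullet> x)" for x
    by (simp add: inner_vec_def sum_negf)
  then show ?thesis
    using E_surj[of p] by (auto simp: monomial_E cis_cnj)
qed

lemma der_monomial:
  "der i (\<lambda>p. Re (monomial \<zeta> k p)) p = - (of_int (k $ i) * Im (monomial \<zeta> k p))"
  "der i (\<lambda>p. Im (monomial \<zeta> k p)) p = of_int (k $ i) * Re (monomial \<zeta> k p)"
proof -
  obtain x where x: "p = E x" using E_surj by blast
  note D = has_derivative_cis_inner[of "\<chi> i. of_int (k $ i)" x]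
  have "frechet_derivative (\<lambda>x. Re (cis ((\<chi> i. of_int (k $ i)) \<bullet> x))) (at x)
      = (\<lambda>w. Re (((\<chi> i. of_int (k $ i)) \<bullet> w) *\<^sub>R (\<i> * cis ((\<chi> i. of_int (k $ i)) \<bullet> x))))"
    by (rule frechet_derivative_at[symmetric]) (rule bounded_linear.has_derivative[OF bounded_linear_Re D])
  then show "der i (\<lambda>p. Re (monomial \<zeta> k p)) p = - (of_int (k $ i) * Im (monomial \<zeta> k p))"
    by (simp only: x der_E smooth_fun_Re smooth_fun_monomial monomial_E) (simp add: inner_axis)
  have "frechet_derivative (\<lambda>x. Im (cis ((\<chi> i. of_int (k $ i)) \<bullet> x))) (at x)
      = (\<lambda>w. Im (((\<chi> i. of_int (k $ i)) \<bullet> w) *\<^sub>R (\<i> * cis ((\<chi> i. of_int (k $ i)) \<bullet> x))))"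
    by (rule frechet_derivative_at[symmetric]) (rule bounded_linear.has_derivative[OF bounded_linear_Im D])
  then show "der i (\<lambda>p. Im (monomial \<zeta> k p)) p = of_int (k $ i) * Re (monomial \<zeta> k p)"
    by (simp only: x der_E smooth_fun_Im smooth_fun_monomial monomial_E) (simp add: inner_axis)
qed

lemma exists_monomial_Re_neq_0: "\<exists>p. Re (monomial \<zeta> k p) \<noteq> 0"
  by (rule exI[of _ "E 0"]) (simp add: monomial_E)

lemma exists_monomial_Im_neq_0:
  assumes "k \<noteq> 0"
  shows "\<exists>p. Im (monomial \<zeta> k p) \<noteq> 0"
proof -
  obtain i where i: "k $ i \<noteq> 0" using assms by (auto simp: vec_eq_iff)
  \<comment> \<open>On the i-th axis the phase is k_i times the coordinate; this point makes it
    pi/2, where \<open>cis\<close> equals \<i>.\<close>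
  have "monomial \<zeta> k (E (axis i (pi / (2 * of_int (k $ i))))) = cis (pi / 2)"
    using i by (simp add: monomial_E inner_axis)
  then show ?thesis by (intro exI[of _ "E (axis i (pi / (2 * of_int (k $ i))))"]) simp
qed

text \<open>Conjugation turns the index k into -k, a different index unless k = 0. For the second
  claim, Re z * Im z is half the imaginary part of z^2, and the integral of z^2 is the inner product
  of the eigenfunctions with indices -k and k.\<close>

lemma
  assumes comp: "compact (UNIV :: 'a set)" and prob: "prob_space \<mu>" and sets: "sets \<mu> = sets borel"
    and onb: "L2_orthonormal_basis \<mu> (monomial \<zeta>)"
  shows L2_inner_monomial_cnj: "k \<noteq> 0 \<Longrightarrow> L2_inner \<mu> (monomial \<zeta> k) (\<lambda>p. cnj (monomial \<zeta> k p)) = 0"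
    and L2_inner_Re_Im_monomial:
      "L2_inner \<mu> (\<lambda>p. of_real (Re (monomial \<zeta> k p))) (\<lambda>p. of_real (Im (monomial \<zeta> k p))) = 0"
proof -
  let ?z = "monomial \<zeta> k"
  have L2: "L2_inner \<mu> (monomial \<zeta> k) (monomial \<zeta> l) = (if k = l then 1 else 0)" for k l
    using onb by (simp add: L2_orthonormal_basis_def)
  have neq: "k \<noteq> - k" if "k \<noteq> 0"
    using that by (auto simp: vec_eq_iff)
  show "L2_inner \<mu> ?z (\<lambda>p. cnj (?z p)) = 0" if "k \<noteq> 0"
    using L2[of k "- k"] neq[OF that] by (simp add: cnj_monomial)
  show "L2_inner \<mu> (\<lambda>p. of_real (Re (?z p))) (\<lambda>p. of_real (Im (?z p))) = 0"
  proof (cases "k = 0")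
    \<comment> \<open>Orthonormality says nothing here, since k = -k; instead the imaginary part of
      the constant 1 is 0.\<close>
    case True
    then have "?z p = 1" for p by (simp add: monomial_def)
    then show ?thesis by (simp add: L2_inner_def)
  next
    case False
    have "(\<integral>p. ?z p * ?z p \<partial>\<mu>) = L2_inner \<mu> (monomial \<zeta> (- k)) ?z"
      by (simp add: L2_inner_def cnj_monomial)
    also have "\<dots> = 0" using L2[of "- k" k] neq[OF False] by simp
    finally have "Im (\<integral>p. ?z p * ?z p \<partial>\<mu>) = 0" by simp
    moreover have "integrable \<mu> (\<lambda>p. ?z p * ?z p)"
      by (rule continuous_imp_integrable[OF comp prob sets])
        (intro continuous_intros smooth_fun_imp_continuous smooth_fun_monomial)
    ultimately have "(\<integral>p. 2 * (Re (?z p) * Im (?z p)) \<partial>\<mu>) = 0"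
      by (simp add: integral_Im[symmetric] mult.commute)
    then have "(\<integral>p. Re (?z p) * Im (?z p) \<partial>\<mu>) = 0" by simp
    then show ?thesis
      unfolding L2_inner_def complex_cnj_complex_of_real of_real_mult[symmetric] integral_complex_of_real
      by simp
  qed
qed

end

section \<open>The Laplacian on Koopman eigenfunctions\<close>

context constant_metric
begin

text \<open>The coefficients are constants and pass through \<open>der k\<close>; what remains is to
  reorder third derivatives.\<close>

lemma der_laplacian_real:
  assumes f: "smooth_fun A f"
  shows "der k (laplacian_real A metric f) p = laplacian_real A metric (der k f) p"
proof -
  have "(\<lambda>q. laplacian_real A metric f q)
      = (\<lambda>q. (- 1) * (\<Sum>i\<in>UNIV. \<Sum>j\<in>UNIV. matrix_inv C $ i $ j * der i (der j f) q))"
    by (simp add: laplacian_real_eq[OF f])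
  then have "der k (laplacian_real A metric f) p
      = (- 1) * (\<Sum>i\<in>UNIV. \<Sum>j\<in>UNIV. matrix_inv C $ i $ j * der k (der i (der j f)) p)"
    by (simp only: der_cmult der_sum smooth_fun_sum smooth_fun_cmult smooth_fun_der f)
  also have "(\<lambda>i j. der k (der i (der j f)) p) = (\<lambda>i j. der i (der j (der k f)) p)"
  proof (intro ext)
    fix i j
    have "der k (der j f) = der j (der k f)" using der_commute[OF f] by blast
    then show "der k (der i (der j f)) p = der i (der j (der k f)) p"
      by (simp add: der_commute[of "der j f" k i] smooth_fun_der f)
  qed
  finally show ?thesis unfolding laplacian_real_eq[OF smooth_fun_der[OF f]] by simp
qed

lemma tvec_laplacian_real:
  assumes f: "smooth_fun A f"
  shows "tvec w p (laplacian_real A metric f) = laplacian_real A metric (\<lambda>q. tvec w q f) p"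
proof -
  have D: "der i (\<lambda>q. \<Sum>k\<in>UNIV. w $ k * g k q) p = (\<Sum>k\<in>UNIV. w $ k * der i (g k) p)"
    if "\<And>k. smooth_fun A (g k)" for g i p
    using that by (simp add: der_sum der_cmult smooth_fun_cmult)
  have "smooth_fun A (\<lambda>q. \<Sum>k\<in>UNIV. w $ k * der k f q)"
    by (intro smooth_fun_sum smooth_fun_cmult smooth_fun_der f)
  moreover have "der j (\<lambda>q. \<Sum>k\<in>UNIV. w $ k * der k f q) = (\<lambda>p. \<Sum>k\<in>UNIV. w $ k * der j (der k f) p)" for j
    by (rule ext) (intro D smooth_fun_der f)
  ultimately have "laplacian_real A metric (\<lambda>q. tvec w q f) p
      = - (\<Sum>i\<in>UNIV. \<Sum>j\<in>UNIV. \<Sum>k\<in>UNIV. matrix_inv C $ i $ j * (w $ k * der i (der j (der k f)) p))"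
    unfolding tvec_def by (simp add: laplacian_real_eq D smooth_fun_der f sum_distrib_left)
  also have "(\<Sum>i\<in>UNIV. \<Sum>j\<in>UNIV. \<Sum>k\<in>UNIV. matrix_inv C $ i $ j * (w $ k * der i (der j (der k f)) p))
      = (\<Sum>k\<in>UNIV. \<Sum>i\<in>UNIV. \<Sum>j\<in>UNIV. matrix_inv C $ i $ j * (w $ k * der i (der j (der k f)) p))"
    by (rule trans[OF sum.cong[OF refl sum.swap] sum.swap])
  finally show ?thesis
    by (simp add: tvec_def der_laplacian_real f laplacian_real_eq smooth_fun_der sum_negf
        sum_distrib_left mult_ac)
qed

lemma smooth_fun_laplacian: "smooth_fun A f \<Longrightarrow> smooth_fun A (laplacian A metric f)"
  unfolding laplacian_def
  by (intro smooth_fun_Complex smooth_fun_laplacian_real smooth_fun_Re smooth_fun_Im)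

lemma laplacian_commute_flow:
  assumes sf: "smooth_flow A \<Phi>" and flow: "\<And>t x. \<Phi> t (E x) = E (x + t *\<^sub>R w)"
    and f: "smooth_fun A f"
  shows "smooth_fun A (flow_field \<Phi> f)"
    and "flow_field \<Phi> (laplacian A metric f) = laplacian A metric (flow_field \<Phi> f)"
proof -
  have ff: "flow_field \<Phi> f = (\<lambda>p. Complex (tvec w p (\<lambda>p. Re (f p))) (tvec w p (\<lambda>p. Im (f p))))"
    if "smooth_fun A f" for f
    by (simp add: fun_eq_iff flow_field_complex[OF sf that] flow_field_eq_tvec[OF flow]
        smooth_fun_Re smooth_fun_Im that)
  have sm: "smooth_fun A (\<lambda>p. tvec w p g)" if "smooth_fun A g" for g
    using smooth_field_smooth[OF smooth_field_angle that] .
  then show "smooth_fun A (flow_field \<Phi> f)"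
    unfolding ff[OF f] by (intro smooth_fun_Complex sm smooth_fun_Re smooth_fun_Im f)
  show "flow_field \<Phi> (laplacian A metric f) = laplacian A metric (flow_field \<Phi> f)"
    unfolding ff[OF smooth_fun_laplacian[OF f]] ff[OF f]
    by (simp add: fun_eq_iff laplacian_def tvec_laplacian_real smooth_fun_Re smooth_fun_Im f)
qed

text \<open>The eigenvalue through the inverse of C; the factors
  \<open>\<Omega> i * \<Omega> j\<close> of the formula with the inverse of B are absorbed in
  it.\<close>

definition eigenvalue :: "int^'m \<Rightarrow> real" where
  "eigenvalue k = (\<Sum>i\<in>UNIV. \<Sum>j\<in>UNIV. matrix_inv C $ i $ j * of_int (k $ i) * of_int (k $ j))"

text \<open>Each derivative exchanges real and imaginary part up to a sign. Two of them produce -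
  k_i k_j, and the minus sign of the Laplacian cancels this one.\<close>

lemma laplacian_real_monomial:
  "laplacian_real A metric (\<lambda>p. Re (monomial \<zeta> k p)) p = eigenvalue k * Re (monomial \<zeta> k p)"
  "laplacian_real A metric (\<lambda>p. Im (monomial \<zeta> k p)) p = eigenvalue k * Im (monomial \<zeta> k p)"
proof -
  have dRe: "der i (\<lambda>p. Re (monomial \<zeta> k p)) = (\<lambda>p. - of_int (k $ i) * Im (monomial \<zeta> k p))"
    and dIm: "der i (\<lambda>p. Im (monomial \<zeta> k p)) = (\<lambda>p. of_int (k $ i) * Re (monomial \<zeta> k p))" for i
    by (simp_all add: fun_eq_iff der_monomial)
  note sm = smooth_fun_Re[OF smooth_fun_monomial[of k]] smooth_fun_Im[OF smooth_fun_monomial[of k]]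
  show "laplacian_real A metric (\<lambda>p. Re (monomial \<zeta> k p)) p = eigenvalue k * Re (monomial \<zeta> k p)"
    unfolding laplacian_real_eq[OF sm(1)] dRe der_cmult[OF sm(2)] dIm eigenvalue_def
    by (simp add: sum_distrib_left sum_distrib_right sum_negf mult_ac)
  show "laplacian_real A metric (\<lambda>p. Im (monomial \<zeta> k p)) p = eigenvalue k * Im (monomial \<zeta> k p)"
    unfolding laplacian_real_eq[OF sm(2)] dIm der_cmult[OF sm(1)] dRe eigenvalue_def
    by (simp add: sum_distrib_left sum_distrib_right sum_negf mult_ac)
qed

text \<open>The complex Laplacian acts on real and imaginary parts separately, so a real-valued
  eigenfunction also calls for the value on the zero function.\<close>

lemma laplacian_real_zero: "laplacian_real A metric (\<lambda>p. 0) p = 0"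
proof -
  have "der j (\<lambda>p. 0) = (\<lambda>p. 0)" for j by (rule ext) simp
  then show ?thesis by (simp add: laplacian_real_eq)
qed

lemma laplace_eigenfunction_monomial: "laplace_eigenfunction A metric (eigenvalue k) (monomial \<zeta> k)"
proof -
  have "\<exists>p. monomial \<zeta> k p \<noteq> 0" using exists_monomial_Re_neq_0[of k] by (metis zero_complex.sel(1))
  then show ?thesis
    by (simp add: laplace_eigenfunction_def smooth_fun_monomial laplacian_def
        laplacian_real_monomial complex_eq_iff)
qed

lemma eigenvalue_uminus: "eigenvalue (- k) = eigenvalue k"
  by (simp add: eigenvalue_def)

lemma laplace_eigenfunction_cnj_monomial:
  "laplace_eigenfunction A metric (eigenvalue k) (\<lambda>p. cnj (monomial \<zeta> k p))"
  using laplace_eigenfunction_monomial[of "- k"] by (simp add: eigenvalue_uminus cnj_monomial)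

lemma laplace_eigenfunction_Re_monomial:
  "laplace_eigenfunction A metric (eigenvalue k) (\<lambda>p. of_real (Re (monomial \<zeta> k p)))"
  using exists_monomial_Re_neq_0[of k]
    smooth_fun_bounded_linear[OF smooth_fun_Re[OF smooth_fun_monomial[of k]] bounded_linear_of_real]
  by (simp add: laplace_eigenfunction_def laplacian_def laplacian_real_monomial
      laplacian_real_zero complex_eq_iff)

text \<open>For k = 0 the imaginary part is identically 0, which
  \<open>laplace_eigenfunction\<close> excludes.\<close>

lemma laplace_eigenfunction_Im_monomial:
  "k \<noteq> 0 \<Longrightarrow> laplace_eigenfunction A metric (eigenvalue k) (\<lambda>p. of_real (Im (monomial \<zeta> k p)))"
  using exists_monomial_Im_neq_0[of k]
    smooth_fun_bounded_linear[OF smooth_fun_Im[OF smooth_fun_monomial[of k]] bounded_linear_of_real]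
  by (simp add: laplace_eigenfunction_def laplacian_def laplacian_real_monomial
      laplacian_real_zero complex_eq_iff)

end

section \<open>The averaged metric\<close>

context angle_coframe
begin

text \<open>The matrix B with the coordinate fields in place of the \<open>v i\<close>, that is,
  with the frequencies divided out.\<close>

definition gram :: "('a \<Rightarrow> real^'d) \<Rightarrow> 'a measure \<Rightarrow> real^'m^'m" where
  "gram F \<mu> = (\<chi> i j. \<integral>p. induced_metric F p (angle_field A \<zeta> i p) (angle_field A \<zeta> j p) \<partial>\<mu>)"

lemma transpose_gram: "transpose (gram F \<mu>) = gram F \<mu>"
  by (simp add: gram_def transpose_def induced_metric_def inner_commute)

text \<open>The quadratic form is the integral of the squared length of the pushforward of
  \<open>tvec x p\<close>. Injectivity on tangent spaces makes this integrand positive at every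
  point, so a probability measure cannot integrate it to 0.\<close>

lemma gram_pos_def:
  fixes F :: "'a \<Rightarrow> real^'d"
  assumes comp: "compact (UNIV :: 'a set)" and prob: "prob_space \<mu>" and sets: "sets \<mu> = sets borel"
    and F: "smooth_embedding A F" and x: "x \<noteq> 0"
  shows "x \<bullet> (gram F \<mu> *v x) > 0"
proof -
  interpret prob_space \<mu> by fact
  define G where "G i p = pushforward F (angle_field A \<zeta> i p)" for i p
  have smF: "smooth_fun A (\<lambda>p. F p $ j)" for j
    using F smooth_fun_bounded_linear[OF _ bounded_linear_vec_nth]
    by (auto simp: smooth_embedding_def)
  have contG: "continuous_on UNIV (G i)" for i
    unfolding G_def pushforward_def der_def[symmetric]
    by (intro continuous_intros smooth_fun_imp_continuous) (rule smooth_fun_der[OF smF])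
  have intG: "integrable \<mu> (\<lambda>p. G i p \<bullet> G j p)" for i j
    by (rule continuous_imp_integrable[OF comp prob sets]) (intro continuous_intros contG)
  have push: "pushforward F (tvec y p) = (\<Sum>i\<in>UNIV. y $ i *\<^sub>R G i p)" for y p
    by (simp add: vec_eq_iff pushforward_def tvec_def G_def der_def)
  have sq: "(norm (pushforward F (tvec x p)))\<^sup>2 = (\<Sum>i\<in>UNIV. \<Sum>j\<in>UNIV. x $ i * (x $ j * (G i p \<bullet> G j p)))" for p
    by (simp add: push power2_norm_eq_inner inner_sum_left inner_sum_right sum_distrib_left inner_commute mult_ac)
  have "x \<bullet> (gram F \<mu> *v x) = (\<Sum>i\<in>UNIV. \<Sum>j\<in>UNIV. x $ i * (x $ j * (\<integral>p. G i p \<bullet> G j p \<partial>\<mu>)))"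
    by (simp add: inner_vec_def matrix_vector_mult_def gram_def induced_metric_def G_def
        sum_distrib_left mult_ac)
  also have "\<dots> = (\<integral>p. (norm (pushforward F (tvec x p)))\<^sup>2 \<partial>\<mu>)"
    unfolding sq by (simp add: Bochner_Integration.integral_sum intG)
  finally have eq: "x \<bullet> (gram F \<mu> *v x) = (\<integral>p. (norm (pushforward F (tvec x p)))\<^sup>2 \<partial>\<mu>)" .
  have integrable: "integrable \<mu> (\<lambda>p. (norm (pushforward F (tvec x p)))\<^sup>2)"
    unfolding sq by (simp add: Bochner_Integration.integrable_sum intG)
  have nz: "pushforward F (tvec x p) \<noteq> 0" for p
  proof
    assume "pushforward F (tvec x p) = 0"
    \<comment> \<open>\<open>smooth_embedding\<close> states injectivity by \<open>inj_on\<close>,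
      so the vector is compared with the zero tangent vector.\<close>
    moreover have "pushforward F (tvec 0 p) = 0" by (simp add: push)
    ultimately have "tvec x p = tvec 0 p"
      using F tvec_in_tangent_space unfolding smooth_embedding_def by (metis inj_onD)
    then have "\<tau> i p (tvec x p) = \<tau> i p (tvec 0 p)" for i by simp
    then show False using x by (simp add: vec_eq_iff)
  qed
  have "(\<integral>p. (norm (pushforward F (tvec x p)))\<^sup>2 \<partial>\<mu>) \<noteq> 0"
  proof
    assume "(\<integral>p. (norm (pushforward F (tvec x p)))\<^sup>2 \<partial>\<mu>) = 0"
    then have "AE p in \<mu>. (norm (pushforward F (tvec x p)))\<^sup>2 = 0"
      using integral_nonneg_eq_0_iff_AE[OF integrable] by simp
    then show False by (simp add: nz)
  qed
  moreover have "(\<integral>p. (norm (pushforward F (tvec x p)))\<^sup>2 \<partial>\<mu>) \<ge> 0" by simp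
  ultimately show ?thesis unfolding eq by linarith
qed

end

lemma matrix_inv_unique:
  fixes B :: "real^'n^'n"
  assumes "B ** N = mat 1"
  shows "invertible B" "matrix_inv B = N"
proof -
  have "N ** B = mat 1" using assms matrix_left_right_inverse by blast
  then show inv: "invertible B" using assms unfolding invertible_def by blast
  have "matrix_inv B = matrix_inv B ** (B ** N)" by (simp add: assms)
  also have "\<dots> = N" by (simp add: matrix_mul_assoc matrix_inv_mult(2)[OF inv])
  finally show "matrix_inv B = N" .
qed

text \<open>The rescaled matrix is D C D with D the diagonal matrix of the a_i, so its inverse is
  D^-1 C^-1 D^-1. The second claim removes the outer factors, as the eigenvalue formula
  does.\<close>

lemma matrix_inv_rescale:
  fixes C :: "real^'n^'n" and a :: "'n \<Rightarrow> real"
  assumes "invertible C" "\<And>i. a i \<noteq> 0"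
  shows "invertible (\<chi> i j. a i * a j * C $ i $ j)"
    and "matrix_inv (\<chi> i j. a i * a j * C $ i $ j) $ i $ j * a i * a j = matrix_inv C $ i $ j"
proof -
  let ?B = "\<chi> i j. a i * a j * C $ i $ j" and ?N = "\<chi> i j. matrix_inv C $ i $ j / (a i * a j)"
  have "(?B ** ?N) $ i $ k = a i / a k * (C ** matrix_inv C) $ i $ k" for i k
    using assms(2) by (simp add: matrix_matrix_mult_def sum_distrib_left field_simps)
  then have *: "?B ** ?N = mat 1"
    using assms by (simp add: vec_eq_iff matrix_inv_mult(1) mat_def)
  show "invertible ?B" by (rule matrix_inv_unique(1)[OF *])
  show "matrix_inv ?B $ i $ j * a i * a j = matrix_inv C $ i $ j"
    using assms(2) by (simp add: matrix_inv_unique(2)[OF *])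
qed

theorem mainTheorem9:
  fixes A :: "('a::{second_countable_topology, t2_space}, real^'m) chart set"
    and \<Phi> :: "real \<Rightarrow> 'a \<Rightarrow> 'a"
    and \<mu> :: "'a measure"
    and T :: real
    and \<Omega> :: "'m \<Rightarrow> real"
    and \<zeta> :: "'m \<Rightarrow> 'a \<Rightarrow> complex"
    and F :: "'a \<Rightarrow> real^'d"
    and v :: "'m \<Rightarrow> 'a vfield"
    and B :: "real^'m^'m"
    and \<beta> :: "'m \<Rightarrow> 'a oneform"
    and gbar :: "'a metric_tensor"
  assumes "smooth_atlas UNIV A"
    and "compact (UNIV :: 'a set)" and "connected (UNIV :: 'a set)"
    and "orientable_atlas UNIV A"
    and "smooth_flow A \<Phi>"
    and "prob_space \<mu>" and "sets \<mu> = sets borel"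
    and "smooth_positive_density A \<mu>"
    and "invariant_measure \<mu> \<Phi>"
    and "T > 0" and "ergodic \<mu> (\<Phi> T)"
    and "rationally_independent \<Omega>"
    and "\<And>i. smooth_fun A (\<zeta> i)"
    and "\<And>i p. norm (\<zeta> i p) = 1"
    and "\<And>i. koopman_eigenfunction \<mu> \<Phi> (\<i> * of_real (\<Omega> i)) (\<zeta> i)"
    and "L2_orthonormal_basis \<mu> (monomial \<zeta>)"
    and "diffeomorphism UNIV A torus torus_atlas (angle_map \<zeta>)"
    and "smooth_embedding A F"
    and v_def: "v = (\<lambda>i. field_scale (\<lambda>_. \<Omega> i) (angle_field A \<zeta> i))"
    and B_def: "B = (\<chi> i j. \<integral>p. induced_metric F p (v i p) (v j p) \<partial>\<mu>)"
    and "\<And>i. smooth_oneform A (\<beta> i)"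
    and "\<And>i j p. \<beta> i p (v j p) = (if i = j then 1 else 0)"
    and gbar_def: "gbar = (\<lambda>p u w. \<Sum>i\<in>UNIV. \<Sum>j\<in>UNIV. B $ i $ j * \<beta> i p u * \<beta> j p w)"
  shows
    "(\<forall>f :: 'a \<Rightarrow> complex. smooth_fun A f \<longrightarrow>
        smooth_fun A (flow_field \<Phi> f) \<and> smooth_fun A (laplacian A gbar f) \<and>
        flow_field \<Phi> (laplacian A gbar f) = laplacian A gbar (flow_field \<Phi> f)) \<and>
     invertible B \<and>
     (\<forall>k :: int^'m.
        let z = monomial \<zeta> k;
            \<eta> = (\<Sum>i\<in>UNIV. \<Sum>j\<in>UNIV.
                   matrix_inv B $ i $ j * \<Omega> i * \<Omega> j * of_int (k $ i) * of_int (k $ j))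
        in koopman_eigenfunction \<mu> \<Phi> (\<i> * of_real (\<Sum>i\<in>UNIV. of_int (k $ i) * \<Omega> i)) z \<and>
           laplace_eigenfunction A gbar \<eta> z \<and>
           laplace_eigenfunction A gbar \<eta> (\<lambda>p. cnj (z p)) \<and>
           laplace_eigenfunction A gbar \<eta> (\<lambda>p. of_real (Re (z p))) \<and>
           L2_inner \<mu> (\<lambda>p. of_real (Re (z p))) (\<lambda>p. of_real (Im (z p))) = 0 \<and>
           (k \<noteq> 0 \<longrightarrow>
              laplace_eigenfunction A gbar \<eta> (\<lambda>p. of_real (Im (z p))) \<and>
              L2_inner \<mu> z (\<lambda>p. cnj (z p)) = 0))"
proof -
  have indep: "rationally_independent \<Omega>" and comp: "compact (UNIV :: 'a set)" and sf: "smooth_flow A \<Phi>"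
    and prob: "prob_space \<mu>" and sets: "sets \<mu> = sets borel" and dens: "smooth_positive_density A \<mu>"
    and sm: "\<And>i. smooth_fun A (\<zeta> i)"
    and eig: "\<And>i. koopman_eigenfunction \<mu> \<Phi> (\<i> * of_real (\<Omega> i)) (\<zeta> i)"
    and onb: "L2_orthonormal_basis \<mu> (monomial \<zeta>)" and F: "smooth_embedding A F"
    and form: "\<And>i. smooth_oneform A (\<beta> i)"
    and dual: "\<And>i j p. \<beta> i p (v j p) = (if i = j then 1 else 0)"
    by fact+
  interpret torus_coordinates A \<zeta>
    by unfold_locales fact+
  \<comment> \<open>A zero frequency would give the rational relation with coefficient 1 at i and 0
    elsewhere.\<close>
  have \<Omega>: "\<Omega> i \<noteq> 0" for i
  proof
    assume "\<Omega> i = 0"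
    then have "(\<Sum>j\<in>UNIV. of_rat (if j = i then 1 else 0) * \<Omega> j) = 0"
      by (intro sum.neutral) auto
    then show False
      using indep[unfolded rationally_independent_def, rule_format, of "\<lambda>j. if j = i then 1 else 0" i] by simp
  qed
  \<comment> \<open>The forms \<beta> are dual to frequency multiples of the coordinate fields; this
    factor makes them dual to the coordinate fields themselves.\<close>
  define \<tau> where "\<tau> i p u = \<Omega> i * \<beta> i p u" for i p u
  have tau_form: "smooth_oneform A (\<tau> i)" for i
    using form[of i] unfolding smooth_oneform_def \<tau>_def
    by (auto simp: distrib_left mult.left_commute intro: smooth_fun_cmult)
  have v_tau: "v j p = (\<lambda>f. \<Omega> j * angle_field A \<zeta> j p f)" for j p
    by (simp add: v_def field_scale_def)
  have tau_dual: "\<tau> i p (angle_field A \<zeta> j p) = (if i = j then 1 else 0)" for i j p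
  proof -
    have "angle_field A \<zeta> j p \<in> tangent_space A p"
      by (simp add: angle_field_eq_tvec tvec_in_tangent_space)
    \<comment> \<open>The zero summand brings the scaled field into the two-term form for which
      one-forms are linear.\<close>
    then have "\<tau> i p (\<lambda>f. \<Omega> j * angle_field A \<zeta> j p f + 0 * angle_field A \<zeta> j p f)
        = \<Omega> j * \<tau> i p (angle_field A \<zeta> j p) + 0 * \<tau> i p (angle_field A \<zeta> j p)"
      using tau_form[of i] unfolding smooth_oneform_def by blast
    moreover have "\<tau> i p (v j p) = (if i = j then \<Omega> i else 0)"
      by (simp add: \<tau>_def dual)
    ultimately show ?thesis
      using \<Omega>[of j] by (auto simp: v_tau)
  qed
  interpret angle_coframe A \<zeta> \<tau>
    by unfold_locales (fact tau_form tau_dual)+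
  interpret constant_metric A \<zeta> \<tau> "gram F \<mu>"
    by unfold_locales (fact transpose_gram gram_pos_def[OF comp prob sets F])+
  have pushforward_v: "pushforward F (v i p) = \<Omega> i *\<^sub>R pushforward F (angle_field A \<zeta> i p)" for i p
    by (simp add: vec_eq_iff pushforward_def v_tau)
  have B_gram: "B = (\<chi> i j. \<Omega> i * \<Omega> j * gram F \<mu> $ i $ j)"
    by (simp add: B_def gram_def vec_eq_iff induced_metric_def pushforward_v mult.assoc)
  \<comment> \<open>The frequency factors of B and those of the forms \<tau> match, leaving the
    constant matrix \<open>gram F \<mu>\<close>.\<close>
  have gbar_metric: "gbar = metric"
    by (simp add: fun_eq_iff gbar_def metric_def \<tau>_def B_gram mult_ac)
  have invB: "invertible B"
    unfolding B_gram by (rule matrix_inv_rescale(1)[OF invertible_coeff \<Omega>])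
  have eigenvalue: "(\<Sum>i\<in>UNIV. \<Sum>j\<in>UNIV.
      matrix_inv B $ i $ j * \<Omega> i * \<Omega> j * of_int (k $ i) * of_int (k $ j)) = eigenvalue k" for k
    unfolding B_gram eigenvalue_def
    by (simp only: matrix_inv_rescale(2)[where a = \<Omega>, OF invertible_coeff \<Omega>])
  define w where "w = (\<chi> i. \<Omega> i)"
  \<comment> \<open>The eigenvalue equation in L^2 becomes a differential equation at every point
    and is then integrated along orbits.\<close>
  have "\<zeta> i (\<Phi> t p) = cis (w $ i * t) * \<zeta> i p" for i t p
    unfolding w_def vec_lambda_beta
    by (rule eigenfunction_along_flow[OF sf sm koopman_eigenfunction_flow_field[OF comp sf prob sets dens sm eig]])
  then have flow: "\<Phi> t (E x) = E (x + t *\<^sub>R w)" for t x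
    by (rule flow_E)
  have monomial_flow: "monomial \<zeta> k (\<Phi> t p) = cis ((\<Sum>i\<in>UNIV. of_int (k $ i) * \<Omega> i) * t) * monomial \<zeta> k p"
    for k t p
    using E_surj[of p] by (auto simp: flow monomial_E cis_mult inner_vec_def w_def algebra_simps
        sum.distrib sum_distrib_left)
  have "koopman_eigenfunction \<mu> \<Phi> (\<i> * of_real (\<Sum>i\<in>UNIV. of_int (k $ i) * \<Omega> i)) (monomial \<zeta> k)" for k
    by (rule koopman_eigenfunctionI[where f = "monomial \<zeta> k", OF prob sets smooth_fun_imp_continuous[OF smooth_fun_monomial]
          norm_monomial monomial_flow])
  then show ?thesis
    unfolding gbar_metric Let_def eigenvalue
    using laplacian_commute_flow[OF sf flow] smooth_fun_laplacian invB laplace_eigenfunction_monomial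
      laplace_eigenfunction_cnj_monomial laplace_eigenfunction_Re_monomial
      laplace_eigenfunction_Im_monomial L2_inner_Re_Im_monomial[OF comp prob sets onb]
      L2_inner_monomial_cnj[OF comp prob sets onb]
    by (intro conjI allI impI)
qed

end
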